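(* Let $Y$ be a single voltage cover of the complete bipartite graph $K_{n,n}$ by the cyclic group of order $d$, where $n,d\ge 3$. For any prime $p$ with $p\nmid n$, the Sylow $p$-subgroup $\mathcal J_p(Y)$ of $\mathcal J(Y)$ has the following (elementary divisor) decomposition: $$\mathcal J_p(Y)\cong(\mathbb Z/p^{2a}\mathbb Z)^{d-2}\oplus(\mathbb Z/p^{2a+b}\mathbb Z)^1,$$ where $p^a$ is the largest power of $p$ dividing $n-1$ and $p^b$ is the largest power of $p$ dividing $d$. In particular, $|\mathcal J_p(Y)|=p^{2a(d-1)+b}$, and the $p$-rank of $\mathcal J(Y)$ is $d-1$.
   Context: Graphs are simple. For a finite connected graph $Y$ with Laplacian $L=D-A$ (degree matrix minus adjacency matrix), the Jacobian $\mathcal J(Y)$ is the cokernel of a reduced Laplacian (the matrix obtained from $L$ by deleting the row and column of one vertex); it is a finite abelian group. Label the vertices of $K_{n,n}$ as $v_1,\dots,v_{2n}$, with $v_i$ adjacent to $v_j$ if and only if $i+j$ is odd. Let $G=\langle\tau\rangle$ be cyclic of order $d$. The single voltage assignment is $\alpha_{1,2}=\tau$, $\alpha_{2,1}=\tau^{-1}$, and $\alpha_{i,j}=1$ (the identity of $G$) for all other ordered pairs $(i,j)$ with $v_i,v_j$ adjacent. The single voltage cover (derived graph) $Y$ has vertex set $\{v_{i,g}:1\le i\le 2n,\ g\in G\}$, with $v_{i,g}$ adjacent to $v_{j,h}$ if and only if $v_i,v_j$ are adjacent in $K_{n,n}$ and $h=g\alpha_{i,j}$. The $p$-rank of a finite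 abelian group is the minimal number of generators of its Sylow $p$-subgroup.
   Formalization: The claim that the p-rank of J(Y) is d-1 is stated only for primes p dividing n-1; if p does not divide n(n-1), then a=0 and J_p(Y) is cyclic of order p^b, so its p-rank is at most 1 < d-1 (e.g. n=d=3, p=5 gives rank 0). *)

theory Defs
  imports "HOL-Algebra.Sylow" "HOL-Algebra.Product_Groups"
    "HOL-Algebra.Multiplicative_Group" "Graph_Theory.Pair_Digraph"
begin

text \<open>Simple graphs are represented by \<^locale>\<open>pair_graph\<close>: finite, symmetric and loop-free,
  with arcs given as ordered pairs.\<close>

section \<open>The Jacobian of a graph\<close>

definition laplacian :: "'a pair_pre_digraph \<Rightarrow> 'a \<Rightarrow> 'a \<Rightarrow> int" where
  "laplacian Y u v =
     (if u = v then int (out_degree (with_proj Y) u) else 0) - of_bool ((u, v) \<in> parcs Y)"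

definition int_vectors :: "'a set \<Rightarrow> ('a \<Rightarrow> int) monoid" where
  "int_vectors W = product_group W (\<lambda>_. integer_group)"

text \<open>Multiplication by the reduced Laplacian, i.e. the Laplacian with the row and the column of
  the vertex \<open>q\<close> deleted.\<close>
definition reduced_laplacian_map ::
    "'a pair_pre_digraph \<Rightarrow> 'a \<Rightarrow> ('a \<Rightarrow> int) \<Rightarrow> ('a \<Rightarrow> int)" where
  "reduced_laplacian_map Y q x =
     (\<lambda>u \<in> pverts Y - {q}. \<Sum>v \<in> pverts Y - {q}. laplacian Y u v * x v)"

definition jacobian :: "'a pair_pre_digraph \<Rightarrow> 'a \<Rightarrow> ('a \<Rightarrow> int) set monoid" where
  "jacobian Y q =
     int_vectors (pverts Y - {q}) Mod
       (reduced_laplacian_map Y q ` carrier (int_vectors (pverts Y - {q})))"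

section \<open>Sylow subgroups and the p-rank\<close>

definition is_sylow_subgroup :: "('a, 'b) monoid_scheme \<Rightarrow> nat \<Rightarrow> 'a set \<Rightarrow> bool" where
  "is_sylow_subgroup G p P \<longleftrightarrow> subgroup P G \<and> card P = p ^ multiplicity p (order G)"

text \<open>The definite description is justified for finite abelian groups by
  \<open>is_sylow_subgroup_sylow_group\<close> below.\<close>
definition sylow_group :: "('a, 'b) monoid_scheme \<Rightarrow> nat \<Rightarrow> ('a, 'b) monoid_scheme" where
  "sylow_group G p = G\<lparr>carrier := (THE P. is_sylow_subgroup G p P)\<rparr>"

definition min_generators :: "('a, 'b) monoid_scheme \<Rightarrow> nat" where
  "min_generators H =
     (LEAST k. \<exists>S. S \<subseteq> carrier H \<and> finite S \<and> card S = k \<and> generate H S = carrier H)"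

definition p_rank :: "('a, 'b) monoid_scheme \<Rightarrow> nat \<Rightarrow> nat" where
  "p_rank G p = min_generators (sylow_group G p)"

section \<open>Voltage covers\<close>

definition complete_bipartite :: "nat \<Rightarrow> nat pair_pre_digraph" where
  "complete_bipartite n =
     \<lparr>pverts = {1..2 * n}, parcs = {(i, j). i \<in> {1..2 * n} \<and> j \<in> {1..2 * n} \<and> odd (i + j)}\<rparr>"

definition derived_graph ::
    "'v pair_pre_digraph \<Rightarrow> ('g, 'm) monoid_scheme \<Rightarrow> ('v \<Rightarrow> 'v \<Rightarrow> 'g) \<Rightarrow> ('v \<times> 'g) pair_pre_digraph" where
  "derived_graph B G \<alpha> =
     \<lparr>pverts = pverts B \<times> carrier G,
      parcs = {((i, g), (j, h)). (i, j) \<in> parcs B \<and> g \<in> carrier G \<and> h \<in> carrier G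
                 \<and> h = g \<otimes>\<^bsub>G\<^esub> \<alpha> i j}\<rparr>"

definition single_voltage :: "('g, 'm) monoid_scheme \<Rightarrow> 'g \<Rightarrow> nat \<Rightarrow> nat \<Rightarrow> 'g" where
  "single_voltage G \<tau> i j =
     (if i = 1 \<and> j = 2 then \<tau> else if i = 2 \<and> j = 1 then inv\<^bsub>G\<^esub> \<tau> else \<one>\<^bsub>G\<^esub>)"

definition single_voltage_cover ::
    "nat \<Rightarrow> ('g, 'm) monoid_scheme \<Rightarrow> 'g \<Rightarrow> (nat \<times> 'g) pair_pre_digraph" where
  "single_voltage_cover n G \<tau> = derived_graph (complete_bipartite n) G (single_voltage G \<tau>)"

section \<open>Well-definedness\<close>

lemma pair_graph_single_voltage_cover:
  fixes G (structure)
  assumes "group G" "finite (carrier G)" "\<tau> \<in> carrier G"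
  shows "pair_graph (single_voltage_cover n G \<tau>)"
proof -
  interpret group G by fact
  let ?Y = "single_voltage_cover n G \<tau>"
  have sub: "parcs ?Y \<subseteq> pverts ?Y \<times> pverts ?Y"
    by (auto simp: single_voltage_cover_def derived_graph_def complete_bipartite_def)
  have fin: "finite (pverts ?Y)"
    using assms(2) by (auto simp: single_voltage_cover_def derived_graph_def complete_bipartite_def)
  have closed: "single_voltage G \<tau> i j \<in> carrier G"
    and inverse: "single_voltage G \<tau> j i = inv (single_voltage G \<tau> i j)" for i j
    using assms(3) by (auto simp: single_voltage_def)
  show ?thesis
  proof
    show "finite (parcs ?Y)" using sub fin by (meson finite_SigmaI finite_subset)
    show "finite (pverts ?Y)" by (fact fin)
    show "fst e \<in> pverts ?Y" "snd e \<in> pverts ?Y" if "e \<in> parcs ?Y" for e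
      using sub that by auto
    show "fst e \<noteq> snd e" if "e \<in> parcs ?Y" for e
      using that by (auto simp: single_voltage_cover_def derived_graph_def complete_bipartite_def)
    have "((j, h), (i, g)) \<in> parcs ?Y" if "((i, g), (j, h)) \<in> parcs ?Y" for i j g h
    proof -
      have g: "g \<in> carrier G" "h \<in> carrier G" and h: "h = g \<otimes> single_voltage G \<tau> i j"
        and ij: "(i, j) \<in> parcs (complete_bipartite n)"
        using that by (auto simp: single_voltage_cover_def derived_graph_def)
      have g_eq: "g = h \<otimes> single_voltage G \<tau> j i"
        using g h inverse[where i = i and j = j] by (metis closed inv_solve_right)
      have ji: "(j, i) \<in> parcs (complete_bipartite n)"
        using ij by (auto simp: complete_bipartite_def)
      show ?thesis
        unfolding single_voltage_cover_def derived_graph_def pair_pre_digraph.simps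
          mem_Collect_eq case_prod_conv
        using ji g g_eq by (intro conjI)
    qed
    then have "sym (parcs ?Y)" by (auto simp: sym_def)
    then show "symmetric (with_proj ?Y)"
      by (simp add: symmetric_def arcs_ends_def arc_to_ends_def)
  qed
qed

lemma comm_group_int_vectors: "comm_group (int_vectors W)"
proof -
  interpret group "int_vectors W" unfolding int_vectors_def by simp
  show ?thesis
    by (rule group_comm_groupI) (auto simp: int_vectors_def fun_eq_iff integer_group_def)
qed

lemma reduced_laplacian_map_hom:
  "reduced_laplacian_map Y q \<in> hom (int_vectors (pverts Y - {q})) (int_vectors (pverts Y - {q}))"
  by (rule homI)
    (auto simp: reduced_laplacian_map_def int_vectors_def fun_eq_iff algebra_simps sum.distrib
      intro!: sum.cong)

lemma comm_group_jacobian: "comm_group (jacobian Y q)"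
proof -
  interpret Z: comm_group "int_vectors (pverts Y - {q})" by (rule comm_group_int_vectors)
  interpret h: group_hom "int_vectors (pverts Y - {q})" "int_vectors (pverts Y - {q})"
    "reduced_laplacian_map Y q"
    by unfold_locales (rule reduced_laplacian_map_hom)
  show ?thesis
    unfolding jacobian_def by (rule Z.abelian_FactGroup) (rule h.img_is_subgroup)
qed

lemma ex1_sylow_subgroup:
  fixes G (structure)
  assumes "comm_group G" "finite (carrier G)" "prime p"
  shows "\<exists>!P. is_sylow_subgroup G p P"
proof -
  interpret comm_group G by fact
  define k where "k = multiplicity p (order G)"
  have ord: "order G > 0" using assms(2) order_gt_0_iff_finite by blast
  obtain m where m: "order G = p ^ k * m" "\<not> p dvd m"
    using ord assms(3) unfolding k_def
    by (metis multiplicity_decompose' not_prime_unit less_numeral_extra(3))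
  have "\<exists>P. is_sylow_subgroup G p P"
    using sylow_thm[OF assms(3) is_group m(1) assms(2)] by (simp add: is_sylow_subgroup_def k_def)
  moreover have "P = {x \<in> carrier G. x [^] (p ^ k) = \<one>}" if "is_sylow_subgroup G p P" for P
  proof
    have sub: "subgroup P G" and card: "card P = p ^ k"
      using that by (auto simp: is_sylow_subgroup_def k_def)
    interpret P: group "G\<lparr>carrier := P\<rparr>" using sub by (rule subgroup.subgroup_is_group) unfold_locales
    show "P \<subseteq> {x \<in> carrier G. x [^] (p ^ k) = \<one>}"
    proof
      fix x assume x: "x \<in> P"
      have "x [^]\<^bsub>G\<lparr>carrier := P\<rparr>\<^esub> order (G\<lparr>carrier := P\<rparr>) = \<one>\<^bsub>G\<lparr>carrier := P\<rparr>\<^esub>"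
        using x by (intro P.pow_order_eq_1) auto
      then show "x \<in> {x \<in> carrier G. x [^] (p ^ k) = \<one>}"
        using x card subgroup.subset[OF sub]
        by (auto simp: order_def nat_pow_def)
    qed
    show "{x \<in> carrier G. x [^] (p ^ k) = \<one>} \<subseteq> P"
    proof clarify
      fix x assume x: "x \<in> carrier G" "x [^] (p ^ k) = \<one>"
      interpret N: normal P G using sub by (rule subgroup_imp_normal)
      interpret F: group "G Mod P" by (rule N.factorgroup_is_group)
      have "card (rcosets P) * card P = order G" using lagrange[OF sub] .
      then have ordF: "order (G Mod P) = m"
        using m(1) card prime_gt_0_nat[OF assms(3)] by (simp add: order_def FactGroup_def)
      have cP: "P #> x \<in> carrier (G Mod P)"
        using x by (auto simp: FactGroup_def RCOSETS_def)
      interpret h: group_hom G "G Mod P" "\<lambda>a. P #> a"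
        by unfold_locales (rule N.r_coset_hom_Mod)
      have "(P #> x) [^]\<^bsub>G Mod P\<^esub> (p ^ k) = \<one>\<^bsub>G Mod P\<^esub>"
        using h.hom_nat_pow[OF x(1), of "p ^ k"] x(2) by simp
      then have d1: "F.ord (P #> x) dvd p ^ k" using F.pow_eq_id[OF cP] by simp
      have d2: "F.ord (P #> x) dvd m" using F.ord_dvd_group_order[OF cP] ordF by simp
      have "coprime (p ^ k) m"
        using m(2) assms(3) by (simp add: prime_imp_coprime)
      then have "F.ord (P #> x) = 1"
        using d1 d2 by (metis coprime_common_divisor_nat)
      then have "P #> x = P"
        using F.ord_eq_1[OF cP] by simp
      then show "x \<in> P" using x(1) sub by (metis rcos_self)
    qed
  qed
  ultimately show ?thesis by blast
qed

lemma is_sylow_subgroup_sylow_group: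
  assumes "comm_group G" "finite (carrier G)" "prime p"
  shows "is_sylow_subgroup G p (carrier (sylow_group G p))"
  using theI'[OF ex1_sylow_subgroup[OF assms]] by (simp add: sylow_group_def)

end

theory Submission
  imports Defs "HOL-Number_Theory.Cong"
begin

text \<open>
  Let \<open>S\<close> be the shift \<open>(S x) g = x (g \<tau>)\<close> on integer functions on \<open>G\<close>. As a matrix over
  \<open>\<int>[S, S\<^sup>-\<^sup>1]\<close> indexed by the base vertices, the Laplacian of the cover can be reduced, after inverting
  \<open>n\<close>, to the single entry \<open>(n - 1)\<^sup>2 (2 - S - S\<^sup>-\<^sup>1)\<close> at the base vertex 1: an explicit row vector
  \<open>\<Psi>\<close> with \<open>\<Psi> L = ((n - 1)\<^sup>2 (2 - S - S\<^sup>-\<^sup>1), 0, \<dots>, 0)\<close>, its transpose, and an elimination modulo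
  the image of \<open>L\<close> show that up to powers of \<open>n\<close> the cokernels agree. So for \<open>p\<close> not dividing \<open>n\<close>
  only the lattice of degree-zero functions \<open>y\<close> on the cycle \<open>\<int>/d\<close> modulo \<open>(n - 1)\<^sup>2\<close> times the image
  of the cycle Laplacian matters. That image consists of the \<open>y\<close> of degree zero with
  \<open>\<Sum>k. k y\<^sub>k\<close> divisible by \<open>d\<close>, hence \<open>y \<mapsto> (y\<^sub>2, \<dots>, y\<^bsub>d-1\<^esub>, \<Sum>k. k y\<^sub>k)\<close> diagonalises the quotient
  with elementary divisors \<open>(n - 1)\<^sup>2\<close> (\<open>d - 2\<close> times) and \<open>(n - 1)\<^sup>2 d\<close>.
\<close>

section \<open>Finite abelian groups\<close>

text \<open>In an abelian group the product of the subgroups generated by \<open>x\<close> and by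
  \<open>S\<close> is again a subgroup. Adjoining one generator therefore multiplies the size by at
  most the order of \<open>x\<close>, which is at most \<open>k\<close>. This later bounds the
  number of generators from below.\<close>

lemma (in comm_group) card_generate_le:
  assumes "finite S" "S \<subseteq> carrier G" "k > 0" "\<And>x. x \<in> carrier G \<Longrightarrow> x [^] (k::nat) = \<one>"
  shows "finite (generate G S) \<and> card (generate G S) \<le> k ^ card S"
  using assms(1,2)
proof (induction S rule: finite_induct)
  case empty
  then show ?case by (simp add: generate_empty)
next
  case (insert x S)
  let ?X = "generate G {x}" and ?S = "generate G S"
  have x: "x \<in> carrier G" and S: "S \<subseteq> carrier G" using insert by auto
  have ord: "ord x \<le> k" "ord x > 0"
    using pow_eq_id[OF x] assms(3,4) x by (auto intro: dvd_imp_le dvd_pos_nat)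
  have card_X: "card ?X \<le> k" using generate_pow_card[OF x] ord by simp
  have fin_X: "finite ?X"
    using generate_pow_card[OF x] ord by (intro card_ge_0_finite) simp
  have image: "?X <#> ?S = (\<lambda>(u, v). u \<otimes> v) ` (?X \<times> ?S)"
    by (auto simp: set_mult_def)
  have "card (?X <#> ?S) \<le> card (?X \<times> ?S)"
    unfolding image using insert S fin_X by (intro card_image_le) auto
  also have "\<dots> \<le> k * k ^ card S"
    using insert S card_X by (simp add: card_cartesian_product mult_le_mono)
  finally have le: "card (?X <#> ?S) \<le> k ^ card (insert x S)" using insert by simp
  have fin: "finite (?X <#> ?S)" unfolding image using insert S fin_X by auto
  have "subgroup (?X <#> ?S) G"
    using x S by (intro mult_subgroups generate_is_subgroup) auto
  moreover have "insert x S \<subseteq> ?X <#> ?S"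
  proof -
    have "x \<otimes> \<one> \<in> ?X <#> ?S" and "\<And>s. s \<in> S \<Longrightarrow> \<one> \<otimes> s \<in> ?X <#> ?S"
      unfolding image by (auto intro!: image_eqI[OF refl] generate.one intro: generate.incl)
    then show ?thesis using x S by (auto simp: subset_iff)
  qed
  ultimately have "generate G (insert x S) \<subseteq> ?X <#> ?S"
    by (intro generate_subgroup_incl) auto
  then show ?case using fin le by (meson card_mono finite_subset le_trans)
qed

text \<open>The kernel of \<open>f\<close> has exponent dividing \<open>m\<close>, hence order prime
  to \<open>p\<close>, so \<open>p ^ k\<close> is the full \<open>p\<close>-part of the order of
  \<open>B\<close>. An element of the Sylow subgroup killed by \<open>f\<close> has order dividing
  both \<open>p ^ k\<close> and \<open>m\<close>, so it is trivial; equal cardinalities then make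
  \<open>f\<close> bijective on that subgroup.\<close>

lemma sylow_group_iso_onto_p_group:
  fixes p m k :: nat
  assumes "comm_group B" "finite (carrier B)" "prime p" "coprime m p"
    and "group T" "card (carrier T) = p ^ k"
    and "f \<in> hom B T" "f ` carrier B = carrier T"
    and kernel: "\<And>x. x \<in> carrier B \<Longrightarrow> f x = \<one>\<^bsub>T\<^esub> \<Longrightarrow> x [^]\<^bsub>B\<^esub> m = \<one>\<^bsub>B\<^esub>"
  shows "sylow_group B p \<cong> T"
proof -
  interpret B: comm_group B by fact
  interpret T: group T by fact
  interpret f: group_hom B T f using assms by unfold_locales auto
  define K where "K = kernel B T f"
  have K: "subgroup K B" unfolding K_def by (rule f.subgroup_kernel)
  interpret BK: group "B\<lparr>carrier := K\<rparr>"
    using K by (rule subgroup.subgroup_is_group) unfold_locales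
  have "\<not> p dvd card K"
  proof
    assume "p dvd card K"
    then obtain c where "order (B\<lparr>carrier := K\<rparr>) = p ^ 1 * c" by (auto simp: order_def)
    moreover have "finite K" using assms(2) K by (meson finite_subset subgroup.subset)
    \<comment> \<open>Cauchy's theorem, as the case of exponent one in Sylow's theorem.\<close>
    ultimately obtain Q where Q: "subgroup Q (B\<lparr>carrier := K\<rparr>)" "card Q = p"
      using sylow_thm[OF assms(3) BK.is_group, of 1 c] by auto
    have QB: "subgroup Q B" using Q(1) K B.incl_subgroup by blast
    have "card Q > 1" using Q(2) assms(3) prime_gt_1_nat by auto
    then obtain x where x: "x \<in> Q" "x \<noteq> \<one>\<^bsub>B\<^esub>"
      using card_mono[of "{\<one>\<^bsub>B\<^esub>}" Q] by fastforce
    have xB: "x \<in> carrier B" using x(1) QB subgroup.mem_carrier by metis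
    interpret Q: group "B\<lparr>carrier := Q\<rparr>"
      using QB by (rule subgroup.subgroup_is_group) unfold_locales
    have "x [^]\<^bsub>B\<lparr>carrier := Q\<rparr>\<^esub> order (B\<lparr>carrier := Q\<rparr>) = \<one>\<^bsub>B\<lparr>carrier := Q\<rparr>\<^esub>"
      using x by (intro Q.pow_order_eq_1) auto
    then have "x [^]\<^bsub>B\<^esub> p = \<one>\<^bsub>B\<^esub>" using Q(2) by (simp add: order_def nat_pow_def)
    moreover have "x \<in> K" using x(1) Q(1) subgroup.subset by force
    then have "x [^]\<^bsub>B\<^esub> m = \<one>\<^bsub>B\<^esub>" using kernel by (simp add: K_def kernel_def)
    ultimately have "B.ord x dvd p" "B.ord x dvd m" using B.pow_eq_id[OF xB] by auto
    then have "B.ord x = 1" using assms(4) by (metis coprime_common_divisor_nat)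
    then show False using B.ord_eq_1[OF xB] x(2) by simp
  qed
  moreover have "order B = p ^ k * card K"
  proof -
    have "(B Mod K) \<cong> T" unfolding K_def using f.FactGroup_iso assms(8) by simp
    then have "card (rcosets\<^bsub>B\<^esub> K) = p ^ k"
      using iso_same_card[of "B Mod K" T] assms(6) by (simp add: FactGroup_def)
    then show ?thesis using B.lagrange[OF K] by simp
  qed
  moreover have "order B > 0" using assms(2) B.order_gt_0_iff_finite by blast
  ultimately have mult: "multiplicity p (order B) = k"
    using assms(3) by (simp add: prime_elem_multiplicity_mult_distrib multiplicity_same_power
        not_dvd_imp_multiplicity_0 prime_gt_0_nat)
  define P where "P = carrier (sylow_group B p)"
  have syl: "subgroup P B" "card P = p ^ k"
    using is_sylow_subgroup_sylow_group[OF assms(1-3)] mult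
    by (auto simp: is_sylow_subgroup_def P_def)
  have PB: "P \<subseteq> carrier B" using syl(1) by (rule subgroup.subset)
  have sylow: "sylow_group B p = B\<lparr>carrier := P\<rparr>" by (simp add: P_def sylow_group_def)
  interpret P: group "B\<lparr>carrier := P\<rparr>"
    using syl(1) by (rule subgroup.subgroup_is_group) unfold_locales
  have fhom: "f \<in> hom (B\<lparr>carrier := P\<rparr>) T"
    using PB f.hom_closed f.hom_mult by (intro homI) (auto simp: subset_iff)
  interpret fP: group_hom "B\<lparr>carrier := P\<rparr>" T f
    using fhom by unfold_locales
  have "inj_on f P"
  proof -
    have "x = \<one>\<^bsub>B\<^esub>" if x: "x \<in> P" "f x = \<one>\<^bsub>T\<^esub>" for x
    proof -
      have xB: "x \<in> carrier B" using x PB by auto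
      have "x [^]\<^bsub>B\<lparr>carrier := P\<rparr>\<^esub> order (B\<lparr>carrier := P\<rparr>) = \<one>\<^bsub>B\<lparr>carrier := P\<rparr>\<^esub>"
        using x by (intro P.pow_order_eq_1) auto
      then have "x [^]\<^bsub>B\<^esub> (p ^ k) = \<one>\<^bsub>B\<^esub>" using syl by (simp add: order_def nat_pow_def)
      moreover have "x [^]\<^bsub>B\<^esub> m = \<one>\<^bsub>B\<^esub>" using kernel x xB by simp
      ultimately have "B.ord x dvd p ^ k" "B.ord x dvd m" using B.pow_eq_id[OF xB] by auto
      moreover have "coprime (p ^ k) m" using assms(4) by (simp add: coprime_commute)
      ultimately have "B.ord x = 1" by (metis coprime_common_divisor_nat)
      then show ?thesis using B.ord_eq_1[OF xB] by simp
    qed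
    then show ?thesis using fP.inj_on_one_iff by simp
  qed
  moreover have "f ` P = carrier T"
  proof (rule card_subset_eq)
    show "finite (carrier T)"
      using assms(3,6) by (metis card.infinite not_prime_0 power_not_zero)
    show "f ` P \<subseteq> carrier T" using PB by auto
    show "card (f ` P) = card (carrier T)"
      using \<open>inj_on f P\<close> syl(2) assms(6) by (simp add: card_image)
  qed
  ultimately show ?thesis
    unfolding sylow using fhom by (intro is_isoI[of f]) (simp add: iso_def bij_betw_def)
qed

text \<open>The same criterion with its conditions stated on representatives: \<open>f\<close>
  vanishes on \<open>H\<close>, so it factors through the quotient, and no computation with cosets
  is left to the applications.\<close>

lemma sylow_group_FactGroup_iso:
  fixes p m k :: nat
  assumes "comm_group A" "subgroup H A" "finite (carrier (A Mod H))" "prime p" "coprime m p"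
    and "group T" "card (carrier T) = p ^ k"
    and "f \<in> hom A T" "f ` carrier A = carrier T" "\<And>x. x \<in> H \<Longrightarrow> f x = \<one>\<^bsub>T\<^esub>"
    and kernel: "\<And>x. x \<in> carrier A \<Longrightarrow> f x = \<one>\<^bsub>T\<^esub> \<Longrightarrow> x [^]\<^bsub>A\<^esub> m \<in> H"
  shows "sylow_group (A Mod H) p \<cong> T"
proof -
  interpret A: comm_group A by fact
  interpret T: group T by fact
  interpret f: group_hom A T f using assms by unfold_locales auto
  have normal: "H \<lhd> A" using assms(2) by (rule A.subgroup_imp_normal)
  interpret H: normal H A by fact
  have "H \<subseteq> kernel A T f"
    using assms(10) by (auto simp: kernel_def)
  then obtain g where g: "g \<in> hom (A Mod H) T"
      "\<And>x. x \<in> carrier A \<Longrightarrow> g (H #>\<^bsub>A\<^esub> x) = f x"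
    by (rule f.FactGroup_universal_kernel[OF normal _ that])
  have onto: "g ` carrier (A Mod H) = carrier T"
    unfolding carrier_FactGroup image_image assms(9)[symmetric] by (rule image_cong[OF refl g(2)])
  have "u [^]\<^bsub>A Mod H\<^esub> m = \<one>\<^bsub>A Mod H\<^esub>" if u: "u \<in> carrier (A Mod H)" "g u = \<one>\<^bsub>T\<^esub>" for u
  proof -
    obtain x where x: "x \<in> carrier A" "u = H #>\<^bsub>A\<^esub> x"
      using u(1) unfolding carrier_FactGroup by blast
    have "f x = \<one>\<^bsub>T\<^esub>" using u(2) g(2)[OF x(1)] by (simp only: x(2))
    then have "H #>\<^bsub>A\<^esub> (x [^]\<^bsub>A\<^esub> m) = H"
      by (intro A.coset_join2 kernel x(1) assms(2) A.nat_pow_closed)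
    then show ?thesis by (simp only: x(2) H.FactGroup_pow[OF x(1)] one_FactGroup)
  qed
  then show ?thesis
    by (rule sylow_group_iso_onto_p_group[OF A.abelian_FactGroup[OF assms(2)] assms(3-7) g(1) onto])
qed

section \<open>Minimal number of generators of a sum of cyclic groups\<close>

lemma min_generators_iso:
  assumes "group A" "group B" "A \<cong> B"
  shows "min_generators A = min_generators B"
proof -
  \<comment> \<open>Stated for arbitrary groups of fresh types, so that it can be used for
    \<open>f\<close> as well as for its inverse.\<close>
  have "\<exists>S'. S' \<subseteq> carrier B \<and> finite S' \<and> card S' = k \<and> generate B S' = carrier B"
    if iso: "f \<in> iso A B" and AB: "group A" "group B" and S: "S \<subseteq> carrier A" "finite S" "card S = k" "generate A S = carrier A"
    for A :: "('x, 'y) monoid_scheme" and B :: "('z, 'w) monoid_scheme" and f S k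
  proof (intro exI conjI)
    interpret A: group A by fact
    interpret B: group B by fact
    interpret f: group_hom A B f using iso by unfold_locales (auto simp: iso_def)
    have bij: "inj_on f (carrier A)" "f ` carrier A = carrier B" using iso by (auto simp: iso_def bij_betw_def)
    show "f ` S \<subseteq> carrier B" "finite (f ` S)" using S by auto
    show "card (f ` S) = k" using S bij by (metis card_image inj_on_subset)
    show "generate B (f ` S) = carrier B" using f.generate_img[OF S(1)] S(4) bij(2) by simp
  qed note transfer = this
  obtain f where f: "f \<in> iso A B" using assms(3) by (auto simp: is_iso_def)
  have g: "inv_into (carrier A) f \<in> iso B A" using group.iso_set_sym[OF assms(1) f] .
  have "(\<exists>S. S \<subseteq> carrier A \<and> finite S \<and> card S = k \<and> generate A S = carrier A) \<longleftrightarrow>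
      (\<exists>S. S \<subseteq> carrier B \<and> finite S \<and> card S = k \<and> generate B S = carrier B)" for k
    by (intro iffI; elim exE conjE; rule transfer[OF f assms(1,2)] transfer[OF g assms(2,1)])
  then show ?thesis unfolding min_generators_def by presburger
qed

abbreviation cyclic_sum :: "nat \<Rightarrow> nat \<Rightarrow> nat \<Rightarrow> ((nat \<Rightarrow> int) \<times> int) monoid" where
  "cyclic_sum r N M \<equiv> product_group {..<r} (\<lambda>_. integer_mod_group N) \<times>\<times> integer_mod_group M"

lemma group_cyclic_sum: "group (cyclic_sum r N M)"
  by (intro DirProd_group product_group group_integer_mod_group)

lemma comm_group_product_integer_mod_group: "comm_group (product_group I (\<lambda>_. integer_mod_group p))"
proof -
  have "group (product_group I (\<lambda>_. integer_mod_group p))"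
    by (rule product_group) (rule group_integer_mod_group)
  then show ?thesis
    by (rule group.group_comm_groupI)
      (simp only: mult_product_group mult_integer_mod_group add.commute)
qed

lemma carrier_cyclic_sum:
  "N > 0 \<Longrightarrow> M > 0 \<Longrightarrow> carrier (cyclic_sum r N M) = ({..<r} \<rightarrow>\<^sub>E {0..<int N}) \<times> {0..<int M}"
  by (simp add: carrier_integer_mod_group)

lemma card_cyclic_sum: "N > 0 \<Longrightarrow> M > 0 \<Longrightarrow> card (carrier (cyclic_sum r N M)) = N ^ r * M"
  by (simp add: carrier_integer_mod_group card_cartesian_product card_PiE)

text \<open>The unit vectors generate. Only an upper bound on their number is claimed, because
  distinct indices give the same element when a factor is trivial.\<close>

lemma cyclic_sum_generators:
  assumes "N > 0" "M > 0"
  obtains S where "S \<subseteq> carrier (cyclic_sum r N M)" "finite S" "card S \<le> Suc r"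
    "generate (cyclic_sum r N M) S = carrier (cyclic_sum r N M)"
proof
  let ?T = "cyclic_sum r N M"
  interpret T: group ?T by (rule group_cyclic_sum)
  define u where "u j m = ((\<lambda>k\<in>{..<r}. if k = j then int m mod int N else 0), 0 :: int)" for j m
  define v where "v m = ((\<lambda>k\<in>{..<r}. 0 :: int), int m mod int M)" for m
  define S where "S = insert (v 1) ((\<lambda>j. u j 1) ` {..<r})"
  have u_closed: "u j m \<in> carrier ?T" and v_closed: "v m \<in> carrier ?T" for j m
    using assms by (auto simp: u_def v_def carrier_cyclic_sum simp del: carrier_DirProd)
  show S: "S \<subseteq> carrier ?T" using u_closed v_closed by (auto simp: S_def simp del: carrier_DirProd)
  show "finite S" by (simp add: S_def)
  have "card S \<le> Suc (card ((\<lambda>j. u j 1) ` {..<r}))" unfolding S_def by (intro card_insert_le_m1) auto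
  also have "\<dots> \<le> Suc r" using card_image_le[of "{..<r}" "\<lambda>j. u j 1"] by simp
  finally show "card S \<le> Suc r" .
  interpret H: subgroup "generate ?T S" ?T using S by (rule T.generate_is_subgroup)
  have one: "u j 0 = \<one>\<^bsub>?T\<^esub>" "v 0 = \<one>\<^bsub>?T\<^esub>" for j
    by (auto simp: u_def v_def)
  have u_gen: "u j m \<in> generate ?T S" if "j < r" for j m
  proof (induction m)
    case 0
    then show ?case using one H.one_closed by simp
  next
    case (Suc m)
    have "u j 1 \<in> generate ?T S" using that by (intro generate.incl) (auto simp: S_def)
    then have "u j m \<otimes>\<^bsub>?T\<^esub> u j 1 \<in> generate ?T S" using Suc by (rule H.m_closed[rotated])
    also have "u j m \<otimes>\<^bsub>?T\<^esub> u j 1 = u j (Suc m)"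
      by (auto simp: u_def fun_eq_iff mod_simps add.commute)
    finally show ?case .
  qed
  have v_gen: "v m \<in> generate ?T S" for m
  proof (induction m)
    case 0
    then show ?case using one H.one_closed by simp
  next
    case (Suc m)
    have "v 1 \<in> generate ?T S" by (intro generate.incl) (auto simp: S_def)
    then have "v m \<otimes>\<^bsub>?T\<^esub> v 1 \<in> generate ?T S" using Suc by (rule H.m_closed[rotated])
    also have "v m \<otimes>\<^bsub>?T\<^esub> v 1 = v (Suc m)"
      by (auto simp: v_def fun_eq_iff mod_simps add.commute)
    finally show ?case .
  qed
  show "generate ?T S = carrier ?T"
  proof
    show "generate ?T S \<subseteq> carrier ?T" by (rule H.subset)
    show "carrier ?T \<subseteq> generate ?T S"
    proof
      fix x assume x: "x \<in> carrier ?T"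
      obtain f c where fc: "x = (f, c)" by fastforce
      have f: "f \<in> {..<r} \<rightarrow>\<^sub>E {0..<int N}" and c: "c \<in> {0..<int M}"
        using x assms by (auto simp: fc carrier_integer_mod_group)
      \<comment> \<open>The coordinates are filled in one at a time: \<open>j\<close> counts those
        already correct, and \<open>j = 0\<close> is a multiple of the generator of the last
        factor.\<close>
      have "((\<lambda>k\<in>{..<r}. if k < j then f k else 0), c) \<in> generate ?T S" if "j \<le> r" for j
        using that
      proof (induction j)
        case 0
        have "v (nat c) = ((\<lambda>k\<in>{..<r}. if k < 0 then f k else 0), c)" using c by (auto simp: v_def)
        then show ?case using v_gen[of "nat c"] by metis
      next
        case (Suc j)
        have fk: "f k mod int N = f k" if "k < r" for k using f that by (auto simp: PiE_iff)
        have fj: "int (nat (f j)) = f j" using f Suc.prems by (auto simp: PiE_iff)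
        have "((\<lambda>k\<in>{..<r}. if k < j then f k else 0), c) \<otimes>\<^bsub>?T\<^esub> u j (nat (f j)) \<in> generate ?T S"
          using Suc.prems by (intro H.m_closed Suc.IH u_gen) auto
        also have "((\<lambda>k\<in>{..<r}. if k < j then f k else 0), c) \<otimes>\<^bsub>?T\<^esub> u j (nat (f j))
            = ((\<lambda>k\<in>{..<r}. if k < Suc j then f k else 0), c)"
          using Suc.prems c fk fj by (auto simp: u_def fun_eq_iff less_Suc_eq)
        finally show ?case .
      qed
      from this[of r] have "((\<lambda>k\<in>{..<r}. if k < r then f k else 0), c) \<in> generate ?T S" by simp
      also have "(\<lambda>k\<in>{..<r}. if k < r then f k else 0) = f"
        using f by (auto simp: fun_eq_iff PiE_iff extensional_def)
      finally show "x \<in> generate ?T S" by (simp add: fc)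
    qed
  qed
qed

text \<open>For the lower bound, reduction of all coordinates modulo \<open>p\<close> is a
  well-defined homomorphism onto the elementary abelian group of order \<open>p ^ Suc r\<close>,
  since \<open>p\<close> divides both moduli. There \<open>k\<close> elements generate at most
  \<open>p ^ k\<close> elements.\<close>

lemma min_generators_cyclic_sum:
  assumes "N > 0" "M > 0" "prime p" "p dvd N" "p dvd M"
  shows "min_generators (cyclic_sum r N M) = Suc r"
proof (rule antisym)
  let ?T = "cyclic_sum r N M" and ?E = "product_group {..<Suc r} (\<lambda>_. integer_mod_group p)"
  let ?P = "\<lambda>k. \<exists>S. S \<subseteq> carrier ?T \<and> finite S \<and> card S = k \<and> generate ?T S = carrier ?T"
  have p: "p > 0" using assms(3) prime_gt_0_nat by blast
  interpret T: group ?T by (rule group_cyclic_sum)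
  obtain S0 where S0: "S0 \<subseteq> carrier ?T" "finite S0" "card S0 \<le> Suc r" "generate ?T S0 = carrier ?T"
    using cyclic_sum_generators[OF assms(1,2)] by blast
  have "(LEAST k. ?P k) \<le> card S0" using S0 by (intro Least_le) blast
  then show "min_generators ?T \<le> Suc r" using S0(3) unfolding min_generators_def by simp
  have "?P (min_generators ?T)"
    unfolding min_generators_def using S0 by (intro LeastI[of ?P "card S0"]) blast
  then obtain S where S: "S \<subseteq> carrier ?T" "finite S" "card S = min_generators ?T" "generate ?T S = carrier ?T"
    by (elim exE conjE) (rule that)
  interpret E: comm_group ?E by (rule comm_group_product_integer_mod_group)
  define h where "h = (\<lambda>(f, c). \<lambda>k\<in>{..<Suc r}. (if k < r then f k else c) mod int p)"
  have h_hom: "h \<in> hom ?T ?E"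
  proof (rule homI)
    fix x assume "x \<in> carrier ?T"
    show "h x \<in> carrier ?E" using p by (simp add: h_def carrier_integer_mod_group split_beta)
  next
    fix x y assume "x \<in> carrier ?T" "y \<in> carrier ?T"
    have "(a mod int N) mod int p = a mod int p" "(a mod int M) mod int p = a mod int p" for a :: int
      using assms(4,5) by (simp_all add: mod_mod_cancel)
    then show "h (x \<otimes>\<^bsub>?T\<^esub> y) = h x \<otimes>\<^bsub>?E\<^esub> h y"
      by (simp add: h_def fun_eq_iff split_beta mult_DirProd' mod_add_eq)
  qed
  interpret h: group_hom ?T ?E h using h_hom by unfold_locales
  have h_onto: "h ` carrier ?T = carrier ?E"
  proof
    show "h ` carrier ?T \<subseteq> carrier ?E" by (rule image_subsetI) (rule h.hom_closed)
    show "carrier ?E \<subseteq> h ` carrier ?T"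
    proof
      fix f assume "f \<in> carrier ?E"
      then have f: "f \<in> {..<Suc r} \<rightarrow>\<^sub>E {0..<int p}" using p by (simp add: carrier_integer_mod_group)
      \<comment> \<open>Residues below \<open>p\<close> are valid representatives modulo
        \<open>N\<close> and \<open>M\<close> too, so the preimage of \<open>f\<close> is
        \<open>f\<close> itself with entry \<open>r\<close> moved to the second component.\<close>
      have le: "int p \<le> int N" "int p \<le> int M" using assms by (auto intro: dvd_imp_le)
      have "f k \<in> {0..<int p}" if "k \<le> r" for k using f that by (auto simp: PiE_iff)
      then have "f k \<in> {0..<int N}" "f k \<in> {0..<int M}" "f k mod int p = f k" if "k \<le> r" for k
        using le that by fastforce+
      then have "(restrict f {..<r}, f r) \<in> carrier ?T" "h (restrict f {..<r}, f r) = f"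
        using f assms(1,2)
        by (auto simp: carrier_integer_mod_group h_def fun_eq_iff PiE_iff extensional_def less_Suc_eq)
      then show "f \<in> h ` carrier ?T" by (metis imageI)
    qed
  qed
  have pow: "x [^]\<^bsub>?E\<^esub> m = (\<lambda>k\<in>{..<Suc r}. (int m * x k) mod int p)" if "x \<in> carrier ?E" for x and m :: nat
    using that p by (induction m) (auto simp: fun_eq_iff mod_simps algebra_simps)
  have "finite (generate ?E (h ` S)) \<and> card (generate ?E (h ` S)) \<le> p ^ card (h ` S)"
    using S p by (intro E.card_generate_le) (auto simp: pow fun_eq_iff simp del: carrier_DirProd carrier_product_group)
  also have "generate ?E (h ` S) = carrier ?E"
    using h.generate_img[OF S(1)] S(4) h_onto by simp
  also have "card (carrier ?E) = p ^ Suc r"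
    using p by (simp add: carrier_integer_mod_group card_PiE)
  finally have "p ^ Suc r \<le> p ^ card (h ` S)" by simp
  then have "Suc r \<le> card (h ` S)" using prime_gt_1_nat[OF assms(3)] by (simp only: power_increasing_iff)
  also have "\<dots> \<le> min_generators ?T" using card_image_le[OF S(2)] S(3) by metis
  finally show "Suc r \<le> min_generators ?T" .
qed

section \<open>Finiteness of quotients of integer lattices\<close>

lemma int_vectors_pow:
  "X \<in> carrier (int_vectors W) \<Longrightarrow> X [^]\<^bsub>int_vectors W\<^esub> m = (\<lambda>v\<in>W. int m * X v)"
  by (induction m) (auto simp: int_vectors_def fun_eq_iff algebra_simps)

text \<open>Division with remainder by \<open>m\<close> in each coordinate: the quotient part
  contributes an \<open>m\<close>-fold multiple, which lies in \<open>H\<close>, so every coset has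
  a representative with entries in \<open>{0..<m}\<close>.\<close>

lemma finite_int_vectors_Mod:
  assumes "finite W" "subgroup H (int_vectors W)" "m > 0"
    and pow: "\<And>X. X \<in> carrier (int_vectors W) \<Longrightarrow> X [^]\<^bsub>int_vectors W\<^esub> (m :: nat) \<in> H"
  shows "finite (carrier (int_vectors W Mod H))"
proof -
  let ?A = "int_vectors W"
  interpret A: comm_group ?A by (rule comm_group_int_vectors)
  have "carrier (?A Mod H) \<subseteq> (\<lambda>X. H #>\<^bsub>?A\<^esub> X) ` (W \<rightarrow>\<^sub>E {0..<int m})"
  proof
    fix C assume "C \<in> carrier (?A Mod H)"
    then obtain X where X: "X \<in> carrier ?A" "C = H #>\<^bsub>?A\<^esub> X" unfolding carrier_FactGroup by blast
    define R where "R = (\<lambda>v\<in>W. X v mod int m)"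
    define D where "D = (\<lambda>v\<in>W. X v div int m)"
    have D: "D \<in> carrier ?A" and R: "R \<in> carrier ?A" by (auto simp: D_def R_def int_vectors_def)
    have "(D [^]\<^bsub>?A\<^esub> m) \<otimes>\<^bsub>?A\<^esub> R = X"
      unfolding int_vectors_pow[OF D] using X(1)
      by (auto simp: D_def R_def int_vectors_def fun_eq_iff PiE_iff extensional_def)
    then have "X \<in> H #>\<^bsub>?A\<^esub> R" using pow[OF D] by (auto simp: r_coset_def)
    then have "C = H #>\<^bsub>?A\<^esub> R" using A.repr_independence[OF _ R assms(2)] X(2) by simp
    moreover have "R \<in> W \<rightarrow>\<^sub>E {0..<int m}" using assms(3) by (auto simp: R_def)
    ultimately show "C \<in> (\<lambda>X. H #>\<^bsub>?A\<^esub> X) ` (W \<rightarrow>\<^sub>E {0..<int m})" by blast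
  qed
  then show ?thesis using assms(1) by (rule finite_subset[OF _ finite_imageI[OF finite_PiE]]) auto
qed

section \<open>The Laplacian of the cover\<close>

text \<open>Only the edge between 1 and 2 carries a nontrivial voltage. The other vertices on one
  side all have the same neighbours with trivial voltages, so they are treated as one class.\<close>

definition odd_rest :: "nat \<Rightarrow> nat set" where
  "odd_rest n = {i \<in> {1..2 * n}. odd i \<and> i \<noteq> 1}"

definition even_rest :: "nat \<Rightarrow> nat set" where
  "even_rest n = {i \<in> {1..2 * n}. even i \<and> i \<noteq> 2}"

lemma finite_rest [simp]: "finite (odd_rest n)" "finite (even_rest n)"
  by (auto simp: odd_rest_def even_rest_def)

lemma not_in_rest [simp]: "1 \<notin> odd_rest n" "Suc 0 \<notin> odd_rest n" "2 \<notin> even_rest n"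
  by (auto simp: odd_rest_def even_rest_def)

lemma odd_eq_insert_rest: "n > 0 \<Longrightarrow> {i \<in> {1..2 * n}. odd i} = insert 1 (odd_rest n)"
  by (auto simp: odd_rest_def)

lemma even_eq_insert_rest: "n > 0 \<Longrightarrow> {i \<in> {1..2 * n}. even i} = insert 2 (even_rest n)"
  by (auto simp: even_rest_def)

lemma card_odd_rest: "card (odd_rest n) = n - 1"
proof -
  have "odd_rest n = (\<lambda>k. 2 * k + 1) ` {1..<n}"
    by (auto simp: odd_rest_def image_iff Bex_def elim!: oddE)
  then show ?thesis by (simp add: card_image inj_on_def)
qed

lemma card_even_rest: "card (even_rest n) = n - 1"
proof -
  have "i \<in> (\<lambda>k. 2 * k + 2) ` {1..<n}" if i: "i \<in> even_rest n" for i
  proof -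
    have "i = 2 * (i div 2 - 1) + 2" "i div 2 - 1 \<in> {1..<n}" using i by (auto simp: even_rest_def elim!: evenE)
    then show ?thesis by blast
  qed
  then have "even_rest n = (\<lambda>k. 2 * k + 2) ` {1..<n}" by (auto simp: even_rest_def)
  then show ?thesis by (simp add: card_image inj_on_def)
qed

lemma rest_cases:
  assumes "i \<in> {1..2 * n}"
  obtains "i = 1" | "i = 2" | "i \<in> odd_rest n" | "i \<in> even_rest n"
  using assms by (auto simp: odd_rest_def even_rest_def)

locale voltage_cover = group G for G :: "('g, 'm) monoid_scheme" (structure) +
  fixes \<tau> :: 'g and n :: nat
  assumes finite_carrier: "finite (carrier G)" and tau [simp]: "\<tau> \<in> carrier G" and n_pos: "n > 0"
begin

abbreviation Y :: "(nat \<times> 'g) pair_pre_digraph" where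
  "Y \<equiv> single_voltage_cover n G \<tau>"

abbreviation \<alpha> :: "nat \<Rightarrow> nat \<Rightarrow> 'g" where
  "\<alpha> \<equiv> single_voltage G \<tau>"

definition nbrs :: "nat \<Rightarrow> nat set" where
  "nbrs i = {j \<in> {1..2 * n}. odd (i + j)}"

section \<open>The Laplacian of the cover, computed on each class of base vertices\<close>

lemma pverts_Y: "pverts Y = {1..2 * n} \<times> carrier G"
  by (simp add: single_voltage_cover_def derived_graph_def complete_bipartite_def)

lemma finite_pverts_Y [simp]: "finite (pverts Y)"
  using finite_carrier by (simp add: pverts_Y)

lemma alpha_closed [simp]: "\<alpha> i j \<in> carrier G"
  by (simp add: single_voltage_def)

lemma shift_cancel [simp]:
  assumes "g \<in> carrier G"
  shows "g \<otimes> \<tau> \<otimes> inv \<tau> = g" "g \<otimes> inv \<tau> \<otimes> \<tau> = g"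
  using assms by (simp_all add: m_assoc)

lemma bij_shift: "bij_betw (\<lambda>g. g \<otimes> \<tau>) (carrier G) (carrier G)"
  by (rule bij_betw_byWitness[where f' = "\<lambda>g. g \<otimes> inv \<tau>"]) auto

lemma sum_shift: "(\<Sum>g\<in>carrier G. f (g \<otimes> \<tau>)) = (\<Sum>g\<in>carrier G. f g)"
  by (rule sum.reindex_bij_betw[OF bij_shift])

lemma nbrs_odd: "odd i \<Longrightarrow> nbrs i = insert 2 (even_rest n)"
  using even_eq_insert_rest[OF n_pos] by (simp add: nbrs_def)

lemma nbrs_even: "even i \<Longrightarrow> nbrs i = insert 1 (odd_rest n)"
  using odd_eq_insert_rest[OF n_pos] by (simp add: nbrs_def)

lemma finite_nbrs [simp]: "finite (nbrs i)" by (simp add: nbrs_def)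

lemma card_nbrs: "card (nbrs i) = n"
  using n_pos by (cases "even i") (simp_all add: nbrs_even nbrs_odd card_odd_rest card_even_rest)

lemma arc_iff:
  assumes "(i, g) \<in> pverts Y"
  shows "((i, g), v) \<in> parcs Y \<longleftrightarrow> v \<in> (\<lambda>j. (j, g \<otimes> \<alpha> i j)) ` nbrs i"
  using assms
  by (cases v) (auto simp: single_voltage_cover_def derived_graph_def complete_bipartite_def nbrs_def)

lemma out_degree_Y:
  assumes "u \<in> pverts Y"
  shows "out_degree (with_proj Y) u = n"
proof -
  obtain i g where u: "u = (i, g)" by fastforce
  have "out_arcs (with_proj Y) u = (\<lambda>j. (u, (j, g \<otimes> \<alpha> i j))) ` nbrs i"
    using arc_iff[of i g] assms unfolding u out_arcs_def by auto
  then show ?thesis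
    by (simp add: out_degree_def card_image inj_on_def card_nbrs)
qed

text \<open>The full Laplacian keeps the block structure over the base vertices, which deleting
  \<open>q\<close> would break. The deletion is dealt with only afterwards, by
  \<open>ext\<close>.\<close>

definition lap :: "(nat \<times> 'g \<Rightarrow> int) \<Rightarrow> nat \<times> 'g \<Rightarrow> int" where
  "lap z u = (\<Sum>v\<in>pverts Y. laplacian Y u v * z v)"

lemma lap_eq:
  assumes "(i, g) \<in> pverts Y"
  shows "lap z (i, g) = int n * z (i, g) - (\<Sum>j\<in>nbrs i. z (j, g \<otimes> \<alpha> i j))"
proof -
  have sub: "(\<lambda>j. (j, g \<otimes> \<alpha> i j)) ` nbrs i \<subseteq> pverts Y"
    using assms by (auto simp: pverts_Y nbrs_def)
  have "lap z (i, g) = (\<Sum>v\<in>pverts Y. (if (i, g) = v then int n * z v else 0)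
      - (if v \<in> (\<lambda>j. (j, g \<otimes> \<alpha> i j)) ` nbrs i then z v else 0))"
    unfolding lap_def
    by (intro sum.cong refl) (auto simp: laplacian_def out_degree_Y[OF assms] arc_iff[OF assms] algebra_simps)
  also have "\<dots> = int n * z (i, g) - (\<Sum>v\<in>(\<lambda>j. (j, g \<otimes> \<alpha> i j)) ` nbrs i. z v)"
    using assms sub by (simp add: sum_subtractf sum.inter_restrict[symmetric] Int_absorb1)
  also have "(\<Sum>v\<in>(\<lambda>j. (j, g \<otimes> \<alpha> i j)) ` nbrs i. z v) = (\<Sum>j\<in>nbrs i. z (j, g \<otimes> \<alpha> i j))"
    by (subst sum.reindex) (auto simp: inj_on_def)
  finally show ?thesis .
qed

definition Odd :: "(nat \<times> 'g \<Rightarrow> int) \<Rightarrow> 'g \<Rightarrow> int" where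
  "Odd x g = (\<Sum>i\<in>odd_rest n. x (i, g))"

definition Even :: "(nat \<times> 'g \<Rightarrow> int) \<Rightarrow> 'g \<Rightarrow> int" where
  "Even x g = (\<Sum>i\<in>even_rest n. x (i, g))"

lemma mem_pverts:
  assumes "g \<in> carrier G"
  shows "(1, g) \<in> pverts Y" "(Suc 0, g) \<in> pverts Y" "(2, g) \<in> pverts Y"
    "i \<in> odd_rest n \<Longrightarrow> (i, g) \<in> pverts Y" "i \<in> even_rest n \<Longrightarrow> (i, g) \<in> pverts Y"
  using assms n_pos by (auto simp: pverts_Y odd_rest_def even_rest_def)

lemma lap_1:
  assumes "g \<in> carrier G"
  shows "lap z (1, g) = int n * z (1, g) - z (2, g \<otimes> \<tau>) - Even z g"
proof -
  have "(\<Sum>j\<in>even_rest n. z (j, g \<otimes> \<alpha> 1 j)) = Even z g"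
    unfolding Even_def using assms by (intro sum.cong refl) (auto simp: single_voltage_def)
  then show ?thesis
    using lap_eq[OF mem_pverts(1)[OF assms], of z] nbrs_odd[of 1] by (simp add: single_voltage_def)
qed

lemma lap_2:
  assumes "g \<in> carrier G"
  shows "lap z (2, g) = int n * z (2, g) - z (1, g \<otimes> inv \<tau>) - Odd z g"
proof -
  have "(\<Sum>j\<in>odd_rest n. z (j, g \<otimes> \<alpha> 2 j)) = Odd z g"
    unfolding Odd_def using assms by (intro sum.cong refl) (auto simp: single_voltage_def)
  then show ?thesis
    using lap_eq[OF mem_pverts(3)[OF assms], of z] nbrs_even[of 2] by (simp add: single_voltage_def)
qed

lemma lap_odd_rest:
  assumes "g \<in> carrier G" "i \<in> odd_rest n"
  shows "lap z (i, g) = int n * z (i, g) - z (2, g) - Even z g"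
proof -
  have i: "odd i" "i \<noteq> 1" "i \<noteq> 2" using assms(2) by (auto simp: odd_rest_def)
  have "(\<Sum>j\<in>even_rest n. z (j, g \<otimes> \<alpha> i j)) = Even z g"
    unfolding Even_def using assms i by (intro sum.cong refl) (auto simp: single_voltage_def)
  then show ?thesis
    using lap_eq[OF mem_pverts(4)[OF assms], of z] nbrs_odd[of i] i assms by (simp add: single_voltage_def)
qed

lemma lap_even_rest:
  assumes "g \<in> carrier G" "i \<in> even_rest n"
  shows "lap z (i, g) = int n * z (i, g) - z (1, g) - Odd z g"
proof -
  have i: "even i" "i \<noteq> 1" "i \<noteq> 2" using assms(2) by (auto simp: even_rest_def)
  have "(\<Sum>j\<in>odd_rest n. z (j, g \<otimes> \<alpha> i j)) = Odd z g"
    unfolding Odd_def using assms i by (intro sum.cong refl) (auto simp: single_voltage_def)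
  then show ?thesis
    using lap_eq[OF mem_pverts(5)[OF assms], of z] nbrs_even[of i] i assms by (simp add: single_voltage_def)
qed

text \<open>Summing over a class closes the system: the class sums of \<open>lap z\<close> depend
  only on the values of \<open>z\<close> at 1 and 2 and on its class sums. Four functions on the
  group thus carry the whole computation.\<close>

lemma Odd_lap: "g \<in> carrier G \<Longrightarrow>
    Odd (lap z) g = int n * Odd z g - (int n - 1) * z (2, g) - (int n - 1) * Even z g"
  using n_pos
  by (simp add: Odd_def lap_odd_rest sum_subtractf sum_distrib_left[symmetric] card_odd_rest of_nat_diff)

lemma Even_lap: "g \<in> carrier G \<Longrightarrow>
    Even (lap z) g = int n * Even z g - (int n - 1) * z (1, g) - (int n - 1) * Odd z g"
  using n_pos
  by (simp add: Even_def lap_even_rest sum_subtractf sum_distrib_left[symmetric] card_even_rest of_nat_diff)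

section \<open>Reduction of the Laplacian to the fibre over vertex 1\<close>

definition vertex_fun :: "('g \<Rightarrow> int) \<Rightarrow> ('g \<Rightarrow> int) \<Rightarrow> (nat \<Rightarrow> 'g \<Rightarrow> int) \<Rightarrow> (nat \<Rightarrow> 'g \<Rightarrow> int)
    \<Rightarrow> nat \<times> 'g \<Rightarrow> int" where
  "vertex_fun f1 f2 fo fe = (\<lambda>(i, g). if i = 1 then f1 g else if i = 2 then f2 g
     else if odd i then fo i g else fe i g)"

lemma vertex_fun_simps [simp]:
  "vertex_fun f1 f2 fo fe (1, g) = f1 g" "vertex_fun f1 f2 fo fe (Suc 0, g) = f1 g"
  "vertex_fun f1 f2 fo fe (2, g) = f2 g"
  "i \<in> odd_rest n \<Longrightarrow> vertex_fun f1 f2 fo fe (i, g) = fo i g"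
  "i \<in> even_rest n \<Longrightarrow> vertex_fun f1 f2 fo fe (i, g) = fe i g"
  "Odd (vertex_fun f1 f2 fo fe) g = (\<Sum>i\<in>odd_rest n. fo i g)"
  "Even (vertex_fun f1 f2 fo fe) g = (\<Sum>i\<in>even_rest n. fe i g)"
proof -
  show *: "i \<in> odd_rest n \<Longrightarrow> vertex_fun f1 f2 fo fe (i, g) = fo i g"
    "i \<in> even_rest n \<Longrightarrow> vertex_fun f1 f2 fo fe (i, g) = fe i g" for i
    by (auto simp: vertex_fun_def odd_rest_def even_rest_def)
  show "Odd (vertex_fun f1 f2 fo fe) g = (\<Sum>i\<in>odd_rest n. fo i g)"
    "Even (vertex_fun f1 f2 fo fe) g = (\<Sum>i\<in>even_rest n. fe i g)"
    by (simp_all add: Odd_def Even_def *)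
qed (simp_all add: vertex_fun_def)

lemma vertex_fun_eqI:
  assumes "u \<in> pverts Y"
    and "\<And>g. g \<in> carrier G \<Longrightarrow> x (1, g) = y (1, g)"
    and "\<And>g. g \<in> carrier G \<Longrightarrow> x (2, g) = y (2, g)"
    and "\<And>i g. g \<in> carrier G \<Longrightarrow> i \<in> odd_rest n \<Longrightarrow> x (i, g) = y (i, g)"
    and "\<And>i g. g \<in> carrier G \<Longrightarrow> i \<in> even_rest n \<Longrightarrow> x (i, g) = y (i, g)"
  shows "x u = y u"
proof -
  obtain i g where u: "u = (i, g)" "i \<in> {1..2 * n}" "g \<in> carrier G"
    using assms(1) by (auto simp: pverts_Y)
  from u(2) show ?thesis by (cases rule: rest_cases) (use assms(2-) u in auto)
qed

text \<open>In terms of \<open>s = S - 1\<close> the coefficients are \<open>n\<^sup>2\<close>, \<open>n\<^sup>2 + n s\<close>, \<open>n\<^sup>2 + (2 n - 1) s\<close> and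
  \<open>n\<^sup>2 + (n - 1) s\<close>; up to a factor they are forced by \<open>\<Psi> L\<close> vanishing away from the vertex 1.\<close>
definition Psi :: "(nat \<times> 'g \<Rightarrow> int) \<Rightarrow> 'g \<Rightarrow> int" where
  "Psi x g = int n^2 * x (1, g)
     + (int n^2 - int n) * Odd x g + int n * Odd x (g \<otimes> \<tau>)
     + (int n - 1)^2 * x (2, g) + (2 * int n - 1) * x (2, g \<otimes> \<tau>)
     + (int n^2 - int n + 1) * Even x g + (int n - 1) * Even x (g \<otimes> \<tau>)"

definition cycle_lap :: "('g \<Rightarrow> int) \<Rightarrow> 'g \<Rightarrow> int" where
  "cycle_lap w g = 2 * w g - w (g \<otimes> \<tau>) - w (g \<otimes> inv \<tau>)"

text \<open>The contributions of \<open>z\<close> at 2 and of both class sums cancel; only the fibre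
  over 1 survives.\<close>

lemma Psi_lap:
  assumes "g \<in> carrier G"
  shows "Psi (lap z) g = (int n - 1)^2 * cycle_lap (\<lambda>h. z (1, h)) g"
  using assms
  by (simp add: Psi_def cycle_lap_def lap_1[unfolded One_nat_def] lap_2 Odd_lap Even_lap power2_eq_square
      algebra_simps)

text \<open>The Laplacian and the cycle Laplacian are symmetric, so transposing the row identity of
  \<open>Psi_lap\<close> gives a column identity. It shows that these functions, supported over
  vertex 1, really are in the image of \<open>lap\<close>.\<close>

lemma lap_at_1:
  fixes u :: "'g \<Rightarrow> int"
  obtains z where "\<And>v. v \<in> pverts Y \<Longrightarrow>
    lap z v = vertex_fun (\<lambda>g. (int n - 1)^2 * cycle_lap u g) (\<lambda>_. 0) (\<lambda>_ _. 0) (\<lambda>_ _. 0) v"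
proof -
  \<comment> \<open>the transpose of \<open>\<Psi>\<close> applied to \<open>u\<close>\<close>
  define z where "z = vertex_fun (\<lambda>g. int n^2 * u g)
      (\<lambda>g. (int n - 1)^2 * u g + (2 * int n - 1) * u (g \<otimes> inv \<tau>))
      (\<lambda>i g. (int n^2 - int n) * u g + int n * u (g \<otimes> inv \<tau>))
      (\<lambda>i g. (int n^2 - int n + 1) * u g + (int n - 1) * u (g \<otimes> inv \<tau>))"
  have Oz: "Odd z g = (int n - 1) * ((int n^2 - int n) * u g + int n * u (g \<otimes> inv \<tau>))"
    and Ez: "Even z g = (int n - 1) * ((int n^2 - int n + 1) * u g + (int n - 1) * u (g \<otimes> inv \<tau>))" for g
    using n_pos unfolding z_def by (simp_all add: card_odd_rest card_even_rest of_nat_diff)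
  have "lap z v = vertex_fun (\<lambda>g. (int n - 1)^2 * cycle_lap u g) (\<lambda>_. 0) (\<lambda>_ _. 0) (\<lambda>_ _. 0) v"
    if "v \<in> pverts Y" for v
    using that
  proof (rule vertex_fun_eqI[where x = "lap z"], goal_cases)
    case (1 g)
    then show ?case
      by (simp only: lap_1 Oz Ez vertex_fun_simps)
        (simp add: z_def cycle_lap_def power2_eq_square algebra_simps)
  next
    case (2 g)
    then show ?case
      by (simp only: lap_2 Oz Ez vertex_fun_simps)
        (simp add: z_def power2_eq_square algebra_simps)
  next
    case (3 i g)
    then show ?case
      by (simp only: lap_odd_rest Oz Ez vertex_fun_simps)
        (simp add: z_def power2_eq_square algebra_simps)
  next
    case (4 i g)
    then show ?case
      by (simp only: lap_even_rest Oz Ez vertex_fun_simps)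
        (simp add: z_def power2_eq_square algebra_simps)
  qed
  then show thesis by (rule that)
qed

lemma reduce_to_1:
  fixes x :: "nat \<times> 'g \<Rightarrow> int"
  obtains y z where "\<And>v. v \<in> pverts Y \<Longrightarrow>
    int n^3 * x v = vertex_fun y (\<lambda>_. 0) (\<lambda>_ _. 0) (\<lambda>_ _. 0) v + lap z v"
proof -
  \<comment> \<open>Modulo the image of \<open>lap\<close>, \<open>n x\<close> becomes \<open>y1\<close> at vertex 1 and \<open>y2\<close> at vertex 2, and a further
    factor \<open>n\<^sup>2\<close> moves \<open>y2\<close> to vertex 1.\<close>
  define y1 where "y1 g = int n * x (1, g) + int n * Odd x g + Even x g - Even x (g \<otimes> \<tau>)" for g
  define y2 where "y2 g = int n * x (2, g) + int n * Even x g + Odd x g - Odd x (g \<otimes> inv \<tau>)" for g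
  define z where "z = vertex_fun (\<lambda>g. - (int n^2) * Odd x g)
      (\<lambda>g. - (int n^2) * Even x g + (2 * int n - 1) * y2 g)
      (\<lambda>i g. int n^2 * x (i, g) + int n * y2 g) (\<lambda>i g. int n^2 * x (i, g) + (int n - 1) * y2 g)"
  define y where "y g = int n^2 * y1 g + (2 * int n - 1) * y2 (g \<otimes> \<tau>) + (int n - 1)^2 * y2 g" for g
  have Oz: "Odd z g = int n^2 * Odd x g + (int n - 1) * (int n * y2 g)"
    and Ez: "Even z g = int n^2 * Even x g + (int n - 1) * ((int n - 1) * y2 g)" for g
    using n_pos unfolding z_def
    by (simp_all add: sum.distrib sum_distrib_left[symmetric] card_odd_rest card_even_rest of_nat_diff
        flip: Odd_def Even_def)
  have "int n^3 * x v = vertex_fun y (\<lambda>_. 0) (\<lambda>_ _. 0) (\<lambda>_ _. 0) v + lap z v"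
    if "v \<in> pverts Y" for v
    using that
  proof (rule vertex_fun_eqI[where x = "\<lambda>v. int n^3 * x v"
        and y = "\<lambda>v. vertex_fun y (\<lambda>_. 0) (\<lambda>_ _. 0) (\<lambda>_ _. 0) v + lap z v"], goal_cases)
    case (1 g)
    then show ?case
      by (simp only: lap_1 Oz Ez vertex_fun_simps)
        (simp add: z_def y_def y1_def power2_eq_square power3_eq_cube algebra_simps)
  next
    case (2 g)
    then show ?case
      by (simp only: lap_2 Oz Ez vertex_fun_simps)
        (simp add: z_def y2_def power2_eq_square power3_eq_cube algebra_simps)
  next
    case (3 i g)
    then show ?case
      by (simp only: lap_odd_rest Oz Ez vertex_fun_simps)
        (simp add: z_def power2_eq_square power3_eq_cube algebra_simps)
  next
    case (4 i g)
    then show ?case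
      by (simp only: lap_even_rest Oz Ez vertex_fun_simps)
        (simp add: z_def power2_eq_square power3_eq_cube algebra_simps)
  qed
  then show thesis by (rule that)
qed

lemma Psi_cong:
  assumes "\<And>v. v \<in> pverts Y \<Longrightarrow> x v = y v" "g \<in> carrier G"
  shows "Psi x g = Psi y g"
proof -
  have "Odd x h = Odd y h" "Even x h = Even y h" "x (1, h) = y (1, h)" "x (2, h) = y (2, h)"
    if "h \<in> carrier G" for h
    using assms(1) mem_pverts[OF that] by (auto simp: Odd_def Even_def)
  then show ?thesis using assms(2) by (simp add: Psi_def)
qed

lemma Psi_linear:
  "Psi (\<lambda>v. a * x v + b * y v) g = a * Psi x g + b * Psi y g"
proof -
  have "Odd (\<lambda>v. a * x v + b * y v) h = a * Odd x h + b * Odd y h"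
    "Even (\<lambda>v. a * x v + b * y v) h = a * Even x h + b * Even y h" for h
    by (simp_all add: Odd_def Even_def sum.distrib sum_distrib_left)
  then show ?thesis by (simp add: Psi_def algebra_simps)
qed

lemma lap_linear: "lap (\<lambda>v. a * x v + b * y v) v = a * lap x v + b * lap y v"
  by (simp add: lap_def sum.distrib sum_distrib_left algebra_simps)

lemma Psi_at_1: "Psi (vertex_fun y (\<lambda>_. 0) (\<lambda>_ _. 0) (\<lambda>_ _. 0)) g = int n^2 * y g"
  by (simp add: Psi_def)

section \<open>Degrees, and membership in the image of the Laplacian\<close>

lemma sum_pverts:
  "(\<Sum>v\<in>pverts Y. x v) = (\<Sum>g\<in>carrier G. x (1, g) + x (2, g) + Odd x g + Even x g)"
proof -
  have "{1..2 * n} = insert 1 (odd_rest n) \<union> insert 2 (even_rest n)"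
    using odd_eq_insert_rest[OF n_pos] even_eq_insert_rest[OF n_pos] by blast
  moreover have "insert 1 (odd_rest n) \<inter> insert 2 (even_rest n) = {}"
    by (auto simp: odd_rest_def even_rest_def)
  ultimately have "(\<Sum>i\<in>{1..2 * n}. x (i, g)) = x (1, g) + x (2, g) + Odd x g + Even x g" for g
    by (simp add: sum.union_disjoint Odd_def Even_def)
  then show ?thesis
    unfolding pverts_Y sum.cartesian_product' by (subst sum.swap) simp
qed

text \<open>Translation by \<open>\<tau>\<close> does not change a sum over the group, and with the
  shift set to 1 the coefficients of each of the four blocks of \<open>Psi\<close> add up to
  \<open>n^2\<close>.\<close>

lemma sum_Psi: "(\<Sum>g\<in>carrier G. Psi x g) = int n^2 * (\<Sum>v\<in>pverts Y. x v)"
  unfolding sum_pverts Psi_def sum.distrib sum_distrib_left[symmetric] sum_shift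
    sum_shift[of "\<lambda>g. x (2, g)"]
  by (simp add: power2_eq_square algebra_simps)

lemma sum_cycle_lap: "(\<Sum>g\<in>carrier G. cycle_lap w g) = 0"
proof -
  have "(\<Sum>g\<in>carrier G. w (g \<otimes> inv \<tau>)) = (\<Sum>g\<in>carrier G. w g)"
    using sum_shift[of "\<lambda>g. w (g \<otimes> inv \<tau>)"] by simp
  then show ?thesis by (simp add: cycle_lap_def sum_subtractf sum_shift sum_distrib_left[symmetric])
qed

lemma sum_lap: "(\<Sum>v\<in>pverts Y. lap z v) = 0"
proof -
  have "int n^2 * (\<Sum>v\<in>pverts Y. lap z v) = (\<Sum>g\<in>carrier G. Psi (lap z) g)" by (simp add: sum_Psi)
  also have "\<dots> = 0" by (simp add: Psi_lap sum_cycle_lap sum_distrib_left[symmetric])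
  finally show ?thesis using n_pos by simp
qed

lemma lap_const: "v \<in> pverts Y \<Longrightarrow> lap (\<lambda>_. c) v = 0"
  using lap_eq[of "fst v" "snd v" "\<lambda>_. c"] by (simp add: card_nbrs)

text \<open>A converse to \<open>Psi_lap\<close> up to powers of \<open>n\<close>. Modulo the image
  of \<open>lap\<close>, \<open>n^3 x\<close> is a function \<open>y\<close> over vertex 1. Applying
  \<open>Psi\<close> shows that \<open>n^2 y\<close> is \<open>(n - 1)^2\<close> times a cycle
  Laplacian, and \<open>lap_at_1\<close> puts that into the image. The exponent 5 is 3 + 2.\<close>

lemma in_image_lap:
  assumes Psi_x: "\<And>g. g \<in> carrier G \<Longrightarrow> Psi x g = (int n - 1)^2 * cycle_lap w g"
  obtains z where "\<And>v. v \<in> pverts Y \<Longrightarrow> int n^5 * x v = lap z v"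
proof -
  let ?at_1 = "\<lambda>y. vertex_fun y (\<lambda>_. 0) (\<lambda>_ _. 0) (\<lambda>_ _. 0)"
  obtain y z where yz: "\<And>v. v \<in> pverts Y \<Longrightarrow> int n^3 * x v = ?at_1 y v + lap z v"
    using reduce_to_1 by metis
  \<comment> \<open>The term \<open>z (1, g)\<close> compensates for what \<open>Psi (lap z)\<close>
    contributes.\<close>
  define u where "u = (\<lambda>g. int n^3 * w g - z (1, g))"
  have y: "int n^2 * y g = (int n - 1)^2 * cycle_lap u g" if g: "g \<in> carrier G" for g
  proof -
    have "int n^3 * Psi x g = Psi (\<lambda>v. int n^3 * x v + 0 * x v) g" by (simp only: Psi_linear)
    also have "\<dots> = Psi (\<lambda>v. 1 * ?at_1 y v + 1 * lap z v) g"
      using yz g by (intro Psi_cong) auto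
    also have "\<dots> = int n^2 * y g + (int n - 1)^2 * cycle_lap (\<lambda>h. z (1, h)) g"
      unfolding Psi_linear by (simp only: Psi_at_1 Psi_lap[OF g])
    finally show ?thesis using Psi_x[OF g] by (simp add: u_def cycle_lap_def algebra_simps)
  qed
  obtain z' where z': "\<And>v. v \<in> pverts Y \<Longrightarrow> lap z' v = ?at_1 (\<lambda>g. (int n - 1)^2 * cycle_lap u g) v"
    using lap_at_1[of u] by metis
  have "int n^5 * x v = lap (\<lambda>v. 1 * z' v + int n^2 * z v) v" if v: "v \<in> pverts Y" for v
  proof -
    have "int n^5 * x v = int n^2 * (int n^3 * x v)" by (simp add: eval_nat_numeral)
    also have "\<dots> = int n^2 * ?at_1 y v + int n^2 * lap z v" unfolding yz[OF v] by (simp add: algebra_simps)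
    also have "int n^2 * ?at_1 y v = lap z' v"
      unfolding z'[OF v] using v by (cases v) (auto simp: vertex_fun_def y pverts_Y)
    finally show ?thesis unfolding lap_linear by simp
  qed
  then show thesis by (rule that)
qed

section \<open>Passage between the reduced and the full Laplacian\<close>

definition ext :: "nat \<times> 'g \<Rightarrow> (nat \<times> 'g \<Rightarrow> int) \<Rightarrow> nat \<times> 'g \<Rightarrow> int" where
  "ext q X v = (if v = q then - (\<Sum>w\<in>pverts Y - {q}. X w) else X v)"

lemma sum_ext: "q \<in> pverts Y \<Longrightarrow> (\<Sum>v\<in>pverts Y. ext q X v) = 0"
  by (simp add: sum.remove[of _ q] ext_def)

lemma reduced_laplacian_eq_lap:
  assumes "q \<in> pverts Y" "u \<in> pverts Y - {q}"
  shows "reduced_laplacian_map Y q z u = lap (z(q := 0)) u"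
  using assms by (simp add: reduced_laplacian_map_def lap_def sum.remove[of _ q])

text \<open>\<open>ext\<close> identifies functions off \<open>q\<close> with functions of degree
  zero on all vertices. As every \<open>lap\<close> image has degree zero, the deleted row at
  \<open>q\<close> is determined by the others and \<open>ext\<close> restores it.\<close>

lemma ext_reduced_laplacian:
  assumes "q \<in> pverts Y" "v \<in> pverts Y"
  shows "ext q (reduced_laplacian_map Y q z) v = lap (z(q := 0)) v"
proof (cases "v = q")
  case True
  have "(\<Sum>w\<in>pverts Y - {q}. reduced_laplacian_map Y q z w) = (\<Sum>w\<in>pverts Y - {q}. lap (z(q := 0)) w)"
    using assms by (intro sum.cong) (auto simp: reduced_laplacian_eq_lap)
  then show ?thesis
    using sum_lap[of "z(q := 0)"] assms(1) True by (simp add: ext_def sum.remove[of _ q])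
next
  case False
  then show ?thesis using assms by (simp add: ext_def reduced_laplacian_eq_lap)
qed

lemma in_image_reduced_laplacian:
  assumes "q \<in> pverts Y" "\<And>v. v \<in> pverts Y \<Longrightarrow> c * ext q X v = lap z v"
  shows "(\<lambda>v\<in>pverts Y - {q}. c * X v) \<in>
    reduced_laplacian_map Y q ` carrier (int_vectors (pverts Y - {q}))"
proof
  \<comment> \<open>Constants lie in the kernel of \<open>lap\<close>, so \<open>z\<close> may be
    shifted to vanish at the deleted vertex.\<close>
  define z' where "z' = (\<lambda>v\<in>pverts Y - {q}. z v - z q)"
  show "z' \<in> carrier (int_vectors (pverts Y - {q}))" by (simp add: z'_def int_vectors_def)
  show "(\<lambda>v\<in>pverts Y - {q}. c * X v) = reduced_laplacian_map Y q z'"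
  proof
    fix u
    show "(\<lambda>v\<in>pverts Y - {q}. c * X v) u = reduced_laplacian_map Y q z' u"
    proof (cases "u \<in> pverts Y - {q}")
      case True
      have "lap (z'(q := 0)) u = lap (\<lambda>v. 1 * z v + (- 1) * z q) u"
        unfolding lap_def by (intro sum.cong) (auto simp: z'_def)
      also have "\<dots> = lap z u" unfolding lap_linear using True by (simp add: lap_const)
      also have "\<dots> = c * X u" using assms(2)[of u] True by (simp add: ext_def)
      finally show ?thesis using reduced_laplacian_eq_lap[OF assms(1) True] True by simp
    next
      case False
      then show ?thesis by (auto simp: reduced_laplacian_map_def)
    qed
  qed
qed

end

section \<open>The cycle Laplacian\<close>

text \<open>Summation by parts, leaving only boundary terms. At \<open>k = 0\<close> the truncated
  index \<open>k - 1\<close> is multiplied by 0.\<close>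

lemma sum_index_second_difference:
  fixes U :: "nat \<Rightarrow> int"
  shows "(\<Sum>k<Suc D. int k * (2 * U k - U (Suc k) - U (k - 1)))
    = (int D + 1) * U D - int D * U (Suc D) - U 0"
  by (induction D) (simp_all add: algebra_simps)

lemma cyclic_second_difference_surj:
  fixes U :: "nat \<Rightarrow> int" and e :: int
  assumes "d > 0" "(\<Sum>k<d. U k) = 0" "(\<Sum>k<d. int k * U k) = int d * e"
  obtains W where "W d = W 0" "- W 1 - W (d - 1) + 2 * W 0 = U 0"
    "\<And>k. 0 < k \<Longrightarrow> 2 * W k - W (Suc k) - W (k - 1) = U k"
proof -
  \<comment> \<open>twofold summation; the slope \<open>- e\<close> makes \<open>W\<close> close up at \<open>d\<close>\<close>
  define W where "W k = - e * int k - (\<Sum>j<k. (int k - int j) * U j)" for k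
  have diff: "W (Suc k) - W k = - e - (\<Sum>j<Suc k. U j)" for k
  proof -
    have "(\<Sum>j<k. (int (Suc k) - int j) * U j) = (\<Sum>j<k. (int k - int j) * U j) + (\<Sum>j<k. U j)"
      by (simp add: sum.distrib[symmetric] algebra_simps)
    then show ?thesis by (simp add: W_def algebra_simps)
  qed
  have "(\<Sum>j<d. (int d - int j) * U j) = int d * (\<Sum>j<d. U j) - (\<Sum>j<d. int j * U j)"
    by (simp add: sum_subtractf sum_distrib_left algebra_simps)
  \<comment> \<open>The double sum at \<open>d\<close> equals \<open>- d * e\<close>, which the
    linear term cancels.\<close>
  then have Wd: "W d = 0" using assms by (simp add: W_def)
  have W0: "W 0 = 0" by (simp add: W_def)
  have second: "2 * W k - W (Suc k) - W (k - 1) = U k" if "0 < k" for k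
    using diff[of k] diff[of "k - 1"] that by simp
  \<comment> \<open>The step from \<open>d - 1\<close> to \<open>d\<close> has slope
    \<open>- e\<close>, the slope assumed before index 0; this gives the equation at 0, where the
    indices wrap around.\<close>
  have "W (d - 1) = e" using diff[of "d - 1"] Wd assms by simp
  moreover have "W 1 = - e - U 0" using diff[of 0] W0 by simp
  ultimately show thesis using that[of W] Wd W0 second by simp
qed

locale cyclic_cover = voltage_cover G \<tau> n
  for G :: "('g, 'm) monoid_scheme" (structure) and \<tau> n +
  fixes d :: nat
  assumes generated: "generate G {\<tau>} = carrier G" and order_d: "order G = d"
begin

section \<open>Powers of the generator as coordinates on the cycle\<close>

lemma ord_tau: "ord \<tau> = d"
  using generate_pow_card[OF tau] generated order_d by (simp add: order_def)

lemma d_pos: "d > 0"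
  using order_d finite_carrier order_gt_0_iff_finite by blast

lemma bij_pow: "bij_betw (\<lambda>k. \<tau> [^] k) {..<d} (carrier G)"
proof -
  have "{0..ord \<tau> - 1} = {..<d}" using d_pos by (auto simp: ord_tau)
  then have inj: "inj_on (\<lambda>k. \<tau> [^] k) {..<d}" using ord_inj[OF tau] by simp
  have "(\<lambda>k. \<tau> [^] k) ` {..<d} = carrier G"
    using finite_carrier card_image[OF inj] order_d
    by (intro card_subset_eq) (auto simp: order_def)
  then show ?thesis using inj by (simp add: bij_betw_def)
qed

lemma sum_pow: "(\<Sum>k<d. f (\<tau> [^] k)) = (\<Sum>g\<in>carrier G. f g)"
  by (rule sum.reindex_bij_betw[OF bij_pow])

lemma pow_d: "\<tau> [^] d = \<one>"
  using pow_ord_eq_1[OF tau] by (simp add: ord_tau)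

lemma pow_inv_tau:
  "0 < k \<Longrightarrow> \<tau> [^] (k::nat) \<otimes> inv \<tau> = \<tau> [^] (k - 1)" "inv \<tau> = \<tau> [^] (d - 1)"
proof -
  show *: "\<tau> [^] (k::nat) \<otimes> inv \<tau> = \<tau> [^] (k - 1)" if "0 < k" for k
    using that by (cases k) (simp_all add: m_assoc)
  show "inv \<tau> = \<tau> [^] (d - 1)" using *[OF d_pos] by (simp add: pow_d)
qed

text \<open>The first moment of a cycle Laplacian telescopes to the jump at the wraparound, where
  the index drops from \<open>d - 1\<close> to 0. This is the source of the extra factor
  \<open>d\<close> in the last elementary divisor.\<close>

lemma sum_index_cycle_lap:
  "(\<Sum>k<d. int k * cycle_lap w (\<tau> [^] k)) = int d * (w (inv \<tau>) - w \<one>)"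
proof -
  have d: "Suc (d - 1) = d" using d_pos by simp
  have "(\<Sum>k<d. int k * cycle_lap w (\<tau> [^] k)) =
      (\<Sum>k<d. int k * (2 * w (\<tau> [^] k) - w (\<tau> [^] Suc k) - w (\<tau> [^] (k - 1))))"
  proof (rule sum.cong[OF refl])
    fix k :: nat
    show "int k * cycle_lap w (\<tau> [^] k)
      = int k * (2 * w (\<tau> [^] k) - w (\<tau> [^] Suc k) - w (\<tau> [^] (k - 1)))"
      using pow_inv_tau(1)[of k] by (cases "k = 0") (simp_all add: cycle_lap_def)
  qed
  also have "\<dots> = int d * (w (inv \<tau>) - w \<one>)"
    using sum_index_second_difference[of "\<lambda>k. w (\<tau> [^] k)" "d - 1", unfolded d] d_pos
    by (simp add: pow_d pow_inv_tau(2) of_nat_diff algebra_simps)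
  finally show ?thesis .
qed

text \<open>The value at exponent 1 enters the first moment with coefficient 1, so \<open>N\<close>
  divides it as well; degree zero then handles exponent 0. After division by \<open>N\<close>,
  degree zero and a first moment divisible by \<open>d\<close> allow the second difference to be
  inverted on the cycle.\<close>

lemma eq_cycle_lap:
  fixes y :: "'g \<Rightarrow> int"
  assumes "d \<ge> 2" "N \<noteq> 0" "(\<Sum>g\<in>carrier G. y g) = 0"
    and dvd: "\<And>k. 2 \<le> k \<Longrightarrow> k < d \<Longrightarrow> N dvd y (\<tau> [^] k)"
    and index_dvd: "N * int d dvd (\<Sum>k<d. int k * y (\<tau> [^] k))"
  obtains w where "\<And>g. g \<in> carrier G \<Longrightarrow> y g = N * cycle_lap w g"
proof -
  define Y' where "Y' k = y (\<tau> [^] k)" for k :: nat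
  have split: "{..<d} = insert 0 (insert 1 {2..<d})" using assms(1) by auto
  have sum0: "(\<Sum>k<d. Y' k) = 0" using assms(3) sum_pow[of y] by (simp add: Y'_def)
  have index: "N dvd (\<Sum>k<d. int k * Y' k)"
    using index_dvd unfolding Y'_def by (rule dvd_mult_left)
  have dvd2: "N dvd Y' k" if "k \<in> {2..<d}" for k using dvd that by (simp add: Y'_def)
  have "(\<Sum>k<d. int k * Y' k) = Y' 1 + (\<Sum>k\<in>{2..<d}. int k * Y' k)"
    unfolding split by simp
  moreover have "N dvd (\<Sum>k\<in>{2..<d}. int k * Y' k)" using dvd2 by (intro dvd_sum dvd_mult)
  ultimately have dvd1: "N dvd Y' 1" using index by (simp add: dvd_add_left_iff)
  have "Y' 0 + Y' 1 + (\<Sum>k\<in>{2..<d}. Y' k) = 0" using sum0 unfolding split by simp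
  moreover have "N dvd Y' 1 + (\<Sum>k\<in>{2..<d}. Y' k)" using dvd1 dvd2 by (intro dvd_add dvd_sum)
  ultimately have dvd0: "N dvd Y' 0"
    by (metis add.assoc add_eq_0_iff2 dvd_minus_iff)
  have dvd_all: "N dvd Y' k" if "k < d" for k
    using that dvd0 dvd1 dvd2[of k] by (cases "k = 0"; cases "k = 1") auto
  define U where "U k = Y' k div N" for k
  have U: "Y' k = N * U k" if "k < d" for k using dvd_all[OF that] by (simp add: U_def)
  have "N * (\<Sum>k<d. U k) = 0" using sum0 U by (simp add: sum_distrib_left)
  then have sumU: "(\<Sum>k<d. U k) = 0" using assms(2) by simp
  have "N * int d dvd N * (\<Sum>k<d. int k * U k)"
    using index_dvd U by (simp add: Y'_def sum_distrib_left mult.left_commute)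
  then obtain e where e: "(\<Sum>k<d. int k * U k) = int d * e" using assms(2) by (auto elim!: dvdE)
  obtain W where W: "W d = W 0" "- W 1 - W (d - 1) + 2 * W 0 = U 0"
      "\<And>k. 0 < k \<Longrightarrow> 2 * W k - W (Suc k) - W (k - 1) = U k"
    by (rule cyclic_second_difference_surj[OF d_pos sumU e]) (rule that)
  define w where "w g = W (inv_into {..<d} (\<lambda>k. \<tau> [^] k) g)" for g
  have w: "w (\<tau> [^] k) = W k" if "k < d" for k
    unfolding w_def using that by (subst inv_into_f_f[OF bij_betw_imp_inj_on[OF bij_pow]]) auto
  \<comment> \<open>The endpoint \<open>k = d\<close> is included because it is the right neighbour
    of \<open>d - 1\<close>.\<close>
  have w_le: "w (\<tau> [^] k) = W k" if "k \<le> d" for k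
  proof (cases "k = d")
    case True
    then show ?thesis using w[OF d_pos] W(1) by (simp add: pow_d)
  next
    case False
    then show ?thesis using that by (intro w) simp
  qed
  have "y g = N * cycle_lap w g" if g: "g \<in> carrier G" for g
  proof -
    obtain k where k: "k < d" "g = \<tau> [^] k" using g bij_pow unfolding bij_betw_def by blast
    have "cycle_lap w (\<tau> [^] k) = U k"
    proof (cases "k = 0")
      case True
      have "w \<one> = W 0" "w \<tau> = W 1" "w (inv \<tau>) = W (d - 1)"
        using w_le[of 0] w_le[of 1] w_le[of "d - 1"] d_pos by (auto simp: pow_inv_tau(2))
      then show ?thesis using True W(2) by (simp add: cycle_lap_def)
    next
      case False
      then have "w (\<tau> [^] k \<otimes> \<tau>) = W (Suc k)" "w (\<tau> [^] k \<otimes> inv \<tau>) = W (k - 1)"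
        using w_le[of "Suc k"] w_le[of "k - 1"] k by (auto simp: pow_inv_tau(1))
      then show ?thesis using False W(3)[of k] w[OF k(1)] by (simp add: cycle_lap_def)
    qed
    then show ?thesis using U[OF k(1)] k(2) by (simp add: Y'_def)
  qed
  then show thesis by (rule that)
qed

section \<open>The Jacobian of the cover\<close>

text \<open>The exponents 0 and 1 are left out: for a function of degree zero the first moment
  recovers the value at 1 from the remaining ones, and the degree then recovers the value at
  0.\<close>

definition coords :: "nat \<Rightarrow> nat \<Rightarrow> ('g \<Rightarrow> int) \<Rightarrow> (nat \<Rightarrow> int) \<times> int" where
  "coords N M y = ((\<lambda>k\<in>{..<d - 2}. y (\<tau> [^] (k + 2)) mod int N),
     (\<Sum>k<d. int k * y (\<tau> [^] k)) mod int M)"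

definition coord_map :: "nat \<times> 'g \<Rightarrow> nat \<Rightarrow> nat \<Rightarrow> (nat \<times> 'g \<Rightarrow> int) \<Rightarrow> (nat \<Rightarrow> int) \<times> int" where
  "coord_map q N M X = coords N M (Psi (ext q X))"

lemma coords_cong:
  assumes "\<And>g. g \<in> carrier G \<Longrightarrow> y g = y' g"
  shows "coords N M y = coords N M y'"
  using assms by (simp add: coords_def)

lemma coords_add:
  "coords N M (\<lambda>g. y g + y' g) = coords N M y \<otimes>\<^bsub>cyclic_sum (d - 2) N M\<^esub> coords N M y'"
  by (simp add: coords_def mod_add_eq distrib_left sum.distrib fun_eq_iff)

lemma coords_closed: "N > 0 \<Longrightarrow> M > 0 \<Longrightarrow> coords N M y \<in> carrier (cyclic_sum (d - 2) N M)"
  by (simp add: coords_def carrier_integer_mod_group)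

lemma coords_eq_one_iff:
  "coords N M y = \<one>\<^bsub>cyclic_sum (d - 2) N M\<^esub> \<longleftrightarrow>
    (\<forall>k. 2 \<le> k \<and> k < d \<longrightarrow> int N dvd y (\<tau> [^] k)) \<and> int M dvd (\<Sum>k<d. int k * y (\<tau> [^] k))"
proof -
  have "(\<forall>k<d - 2. int N dvd y (\<tau> [^] (k + 2))) \<longleftrightarrow> (\<forall>k. 2 \<le> k \<and> k < d \<longrightarrow> int N dvd y (\<tau> [^] k))"
  proof (intro iffI allI impI)
    fix k assume *: "\<forall>k<d - 2. int N dvd y (\<tau> [^] (k + 2))" and k: "2 \<le> k \<and> k < d"
    have "int N dvd y (\<tau> [^] (k - 2 + 2))" using k by (intro *[rule_format]) auto
    also have "k - 2 + 2 = k" using conjunct1[OF k] by simp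
    finally show "int N dvd y (\<tau> [^] k)" .
  next
    fix k assume *: "\<forall>k. 2 \<le> k \<and> k < d \<longrightarrow> int N dvd y (\<tau> [^] k)" and k: "k < d - 2"
    show "int N dvd y (\<tau> [^] (k + 2))" using k by (intro *[rule_format]) auto
  qed
  then show ?thesis
    unfolding coords_def by (simp add: fun_eq_iff dvd_eq_mod_eq_0)
qed

lemma coord_map_hom:
  assumes "N > 0" "M > 0"
  shows "coord_map q N M \<in> hom (int_vectors (pverts Y - {q})) (cyclic_sum (d - 2) N M)"
proof (rule homI)
  show "coord_map q N M X \<in> carrier (cyclic_sum (d - 2) N M)" for X
    unfolding coord_map_def using assms by (rule coords_closed)
  fix X X'
  have "ext q (X \<otimes>\<^bsub>int_vectors (pverts Y - {q})\<^esub> X') v = 1 * ext q X v + 1 * ext q X' v"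
    if "v \<in> pverts Y" for v
    using that by (simp add: ext_def int_vectors_def sum.distrib)
  note ext_mult = this
  have "Psi (ext q (X \<otimes>\<^bsub>int_vectors (pverts Y - {q})\<^esub> X')) g = Psi (ext q X) g + Psi (ext q X') g"
    if "g \<in> carrier G" for g
  proof -
    have "Psi (ext q (X \<otimes>\<^bsub>int_vectors (pverts Y - {q})\<^esub> X')) g
        = Psi (\<lambda>v. 1 * ext q X v + 1 * ext q X' v) g"
      using that by (intro Psi_cong ext_mult)
    then show ?thesis unfolding Psi_linear by simp
  qed
  then show "coord_map q N M (X \<otimes>\<^bsub>int_vectors (pverts Y - {q})\<^esub> X')
      = coord_map q N M X \<otimes>\<^bsub>cyclic_sum (d - 2) N M\<^esub> coord_map q N M X'"
    unfolding coord_map_def coords_add[symmetric] by (rule coords_cong)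
qed

text \<open>The preimage is supported over vertex 1, where \<open>Psi\<close> is multiplication by
  \<open>n^2\<close>. This factor is invertible modulo \<open>M\<close>, hence modulo
  \<open>N\<close>, with inverse \<open>r\<close>.\<close>

lemma coord_map_onto:
  assumes "N > 0" "M > 0" "N dvd M" "coprime n M" "d \<ge> 2" "q \<in> pverts Y"
  shows "coord_map q N M ` carrier (int_vectors (pverts Y - {q})) = carrier (cyclic_sum (d - 2) N M)"
proof
  let ?A = "int_vectors (pverts Y - {q})" and ?T = "cyclic_sum (d - 2) N M"
  show "coord_map q N M ` carrier ?A \<subseteq> carrier ?T"
    unfolding coord_map_def using coords_closed[OF assms(1,2)] by blast
  show "carrier ?T \<subseteq> coord_map q N M ` carrier ?A"
  proof
    fix t assume t: "t \<in> carrier ?T"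
    obtain f c where fc: "t = (f, c)" by fastforce
    have f: "f \<in> {..<d - 2} \<rightarrow>\<^sub>E {0..<int N}" and c: "c \<in> {0..<int M}"
      using t assms by (auto simp: fc carrier_integer_mod_group)
    have "coprime (int n^2) (int M)" using assms(4) by simp
    then obtain r where r: "[int n^2 * r = 1] (mod int M)" using cong_solve_coprime_int by blast
    then have rN: "[int n^2 * r = 1] (mod int N)" using assms(3) cong_dvd_modulus by fastforce
    define F where "F k = r * f (k - 2)" for k
    \<comment> \<open>The value at exponent 1 adjusts the first moment to \<open>r * c\<close>; the
      value at 0 then makes the degree zero.\<close>
    define y1 where "y1 = r * c - (\<Sum>k\<in>{2..<d}. int k * F k)"
    define Yk where "Yk k = (if k = 0 then - y1 - (\<Sum>k\<in>{2..<d}. F k) else if k = 1 then y1 else F k)" for k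
    define y where "y g = Yk (inv_into {..<d} (\<lambda>k. \<tau> [^] k) g)" for g
    have y: "y (\<tau> [^] k) = Yk k" if "k < d" for k
      unfolding y_def using that by (subst inv_into_f_f[OF bij_betw_imp_inj_on[OF bij_pow]]) auto
    have split: "{..<d} = insert 0 (insert 1 {2..<d})" using assms(5) by auto
    have sum_Yk: "(\<Sum>k<d. Yk k) = 0" "(\<Sum>k<d. int k * Yk k) = r * c"
      unfolding split by (simp_all add: Yk_def y1_def)
    define x where "x = vertex_fun y (\<lambda>_. 0) (\<lambda>_ _. 0) (\<lambda>_ _. 0)"
    have "int n^2 * (\<Sum>v\<in>pverts Y. x v) = (\<Sum>g\<in>carrier G. int n^2 * y g)"
      unfolding x_def by (simp only: Psi_at_1 flip: sum_Psi)
    also have "\<dots> = int n^2 * (\<Sum>k<d. y (\<tau> [^] k))" by (simp only: sum_distrib_left sum_pow[of "\<lambda>g. int n^2 * y g"])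
    also have "\<dots> = 0" using sum_Yk(1) y by simp
    finally have "(\<Sum>v\<in>pverts Y. x v) = 0" using n_pos by simp
    \<comment> \<open>Because \<open>x\<close> has degree zero, dropping its value at
      \<open>q\<close> loses nothing: \<open>ext\<close> recovers it.\<close>
    then have xq: "x q = - (\<Sum>v\<in>pverts Y - {q}. x v)" using assms(6) by (simp add: sum.remove[of _ q])
    have ext: "ext q (restrict x (pverts Y - {q})) v = x v" if "v \<in> pverts Y" for v
      using that xq by (simp add: ext_def)
    have "coord_map q N M (restrict x (pverts Y - {q})) = coords N M (\<lambda>g. int n^2 * y g)"
      unfolding coord_map_def
    proof (rule coords_cong)
      fix g assume "g \<in> carrier G"
      from Psi_cong[OF ext this] show "Psi (ext q (restrict x (pverts Y - {q}))) g = int n^2 * y g"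
        by (simp only: x_def Psi_at_1)
    qed
    also have "\<dots> = (f, c)"
      unfolding coords_def
    proof (intro prod_eqI)
      have "(\<Sum>k<d. int k * (int n^2 * y (\<tau> [^] k))) = int n^2 * (\<Sum>k<d. int k * Yk k)"
        using y by (simp add: sum_distrib_left mult.left_commute)
      also have "\<dots> = int n^2 * r * c" by (simp only: sum_Yk(2) mult.assoc)
      also have "[int n^2 * r * c = 1 * c] (mod int M)" using r by (rule cong_mult[OF _ cong_refl])
      finally show "snd ((\<lambda>k\<in>{..<d - 2}. int n^2 * y (\<tau> [^] (k + 2)) mod int N),
          (\<Sum>k<d. int k * (int n^2 * y (\<tau> [^] k))) mod int M) = snd (f, c)"
        using c by (simp add: cong_def)
      have "int n^2 * y (\<tau> [^] (k + 2)) mod int N = f k" if "k < d - 2" for k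
      proof -
        have "int n^2 * y (\<tau> [^] (k + 2)) = int n^2 * r * f k"
          using y[of "k + 2"] that by (simp only: Yk_def F_def) simp
        also have "[int n^2 * r * f k = 1 * f k] (mod int N)" using rN by (rule cong_mult[OF _ cong_refl])
        finally show ?thesis using PiE_mem[OF f, of k] that by (simp add: cong_def)
      qed
      then show "fst ((\<lambda>k\<in>{..<d - 2}. int n^2 * y (\<tau> [^] (k + 2)) mod int N),
          (\<Sum>k<d. int k * (int n^2 * y (\<tau> [^] k))) mod int M) = fst (f, c)"
        using f by (auto simp: fun_eq_iff PiE_iff extensional_def)
    qed
    finally have "t = coord_map q N M (restrict x (pverts Y - {q}))" by (simp add: fc)
    moreover have "restrict x (pverts Y - {q}) \<in> carrier ?A" by (simp add: int_vectors_def)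
    ultimately show "t \<in> coord_map q N M ` carrier ?A" by blast
  qed
qed

text \<open>\<open>Psi\<close> turns the image of the Laplacian into \<open>(n - 1)^2\<close> times
  cycle Laplacians, whose first moments are divisible by \<open>d\<close>. Hence
  \<open>coord_map\<close> descends to the Jacobian.\<close>

lemma coord_map_reduced_laplacian:
  assumes "int N dvd (int n - 1)^2" "int M dvd (int n - 1)^2 * int d" "q \<in> pverts Y"
  shows "coord_map q N M (reduced_laplacian_map Y q z) = \<one>\<^bsub>cyclic_sum (d - 2) N M\<^esub>"
proof -
  define w where "w h = (z(q := 0)) (1, h)" for h
  have "Psi (ext q (reduced_laplacian_map Y q z)) g = (int n - 1)^2 * cycle_lap w g"
    if g: "g \<in> carrier G" for g
  proof -
    have "Psi (ext q (reduced_laplacian_map Y q z)) g = Psi (lap (z(q := 0))) g"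
      using ext_reduced_laplacian[OF assms(3)] g by (rule Psi_cong)
    then show ?thesis unfolding Psi_lap[OF g] w_def .
  qed
  then have "coord_map q N M (reduced_laplacian_map Y q z) = coords N M (\<lambda>g. (int n - 1)^2 * cycle_lap w g)"
    unfolding coord_map_def by (rule coords_cong)
  also have "\<dots> = \<one>\<^bsub>cyclic_sum (d - 2) N M\<^esub>"
  proof -
    have "(\<Sum>k<d. int k * ((int n - 1)^2 * cycle_lap w (\<tau> [^] k)))
        = (int n - 1)^2 * (\<Sum>k<d. int k * cycle_lap w (\<tau> [^] k))"
      by (simp add: sum_distrib_left mult.left_commute)
    also have "\<dots> = (int n - 1)^2 * int d * (w (inv \<tau>) - w \<one>)" by (simp only: sum_index_cycle_lap mult.assoc)
    finally show ?thesis using assms(1,2) unfolding coords_eq_one_iff by simp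
  qed
  finally show ?thesis .
qed

text \<open>The factor \<open>c\<close> makes up for the parts of \<open>(n - 1)^2\<close> and
  \<open>d\<close> that \<open>N\<close> and \<open>M\<close> miss, so that
  \<open>eq_cycle_lap\<close> applies; \<open>n^5\<close> is the price of
  \<open>in_image_lap\<close>.\<close>

lemma coord_map_kernel:
  assumes "n \<ge> 2" "d \<ge> 2" "q \<in> pverts Y" "X \<in> carrier (int_vectors (pverts Y - {q}))"
    and dvd: "(int n - 1)^2 dvd int c * int N" "(int n - 1)^2 * int d dvd int c * int M"
    and one: "coord_map q N M X = \<one>\<^bsub>cyclic_sum (d - 2) N M\<^esub>"
  shows "X [^]\<^bsub>int_vectors (pverts Y - {q})\<^esub> (n^5 * c) \<in>
    reduced_laplacian_map Y q ` carrier (int_vectors (pverts Y - {q}))"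
proof -
  define y where "y = Psi (ext q X)"
  have y: "int N dvd y (\<tau> [^] k)" if "2 \<le> k" "k < d" for k
    using one that unfolding coord_map_def coords_eq_one_iff y_def by blast
  have y_index: "int M dvd (\<Sum>k<d. int k * y (\<tau> [^] k))"
    using one unfolding coord_map_def coords_eq_one_iff y_def by blast
  have sum_y: "(\<Sum>g\<in>carrier G. y g) = 0"
    unfolding y_def sum_Psi by (simp add: sum_ext[OF assms(3)])
  obtain w where w: "\<And>g. g \<in> carrier G \<Longrightarrow> int c * y g = (int n - 1)^2 * cycle_lap w g"
  proof (rule eq_cycle_lap[of "(int n - 1)^2" "\<lambda>g. int c * y g"])
    show "d \<ge> 2" "(int n - 1)^2 \<noteq> 0" using assms(1,2) by auto
    show "(\<Sum>g\<in>carrier G. int c * y g) = 0" using sum_y by (simp flip: sum_distrib_left)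
    show "(int n - 1)^2 dvd int c * y (\<tau> [^] k)" if "2 \<le> k" "k < d" for k
      using dvd(1) mult_dvd_mono[OF dvd_refl y[OF that]] by (rule dvd_trans)
    have "(\<Sum>k<d. int k * (int c * y (\<tau> [^] k))) = int c * (\<Sum>k<d. int k * y (\<tau> [^] k))"
      by (simp add: sum_distrib_left mult.left_commute)
    then show "(int n - 1)^2 * int d dvd (\<Sum>k<d. int k * (int c * y (\<tau> [^] k)))"
      using dvd_trans[OF dvd(2) mult_dvd_mono[OF dvd_refl y_index]] by simp
  qed (rule that)
  \<comment> \<open>The zero summand brings a scalar multiple into the form of
    \<open>Psi_linear\<close>.\<close>
  have Psi_c: "Psi (\<lambda>v. int c * ext q X v + 0 * ext q X v) g = (int n - 1)^2 * cycle_lap w g"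
    if "g \<in> carrier G" for g
    unfolding Psi_linear using w[OF that] by (simp add: y_def)
  obtain z where z: "\<And>v. v \<in> pverts Y \<Longrightarrow>
      int n^5 * (int c * ext q X v + 0 * ext q X v) = lap z v"
    by (rule in_image_lap[OF Psi_c]) (assumption, rule that)
  have "int (n^5 * c) * ext q X v = lap z v" if "v \<in> pverts Y" for v
    using z[OF that] by simp
  from in_image_reduced_laplacian[OF assms(3) this] show ?thesis
    unfolding int_vectors_pow[OF assms(4)] .
qed

text \<open>With the moduli taken as the \<open>p\<close>-parts of \<open>(n - 1)^2\<close> and
  \<open>(n - 1)^2 d\<close>, the coordinate map satisfies the criterion
  \<open>sylow_group_FactGroup_iso\<close>.\<close>

lemma jacobian_sylow:
  assumes "n \<ge> 2" "d \<ge> 2" "q \<in> pverts Y" "prime p" "\<not> p dvd n"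
    and "a = multiplicity p (n - 1)" "b = multiplicity p d"
  defines "T \<equiv> cyclic_sum (d - 2) (p ^ (2 * a)) (p ^ (2 * a + b))"
  shows "finite (carrier (jacobian Y q)) \<and> sylow_group (jacobian Y q) p \<cong> T"
proof -
  define A where "A = int_vectors (pverts Y - {q})"
  define H where "H = reduced_laplacian_map Y q ` carrier A"
  define f where "f = coord_map q (p ^ (2 * a)) (p ^ (2 * a + b))"
  have p: "p > 0" using assms(4) prime_gt_0_nat by blast
  have "n - 1 \<noteq> 0" "\<not> is_unit p" using assms(1,4) not_prime_unit by auto
  then obtain n' where n': "n - 1 = p ^ a * n'" "\<not> p dvd n'"
    by (rule multiplicity_decompose'[of "n - 1" p, folded assms(6)]) (rule that)
  have "d \<noteq> 0" "\<not> is_unit p" using d_pos assms(4) not_prime_unit by auto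
  then obtain d' where d': "d = p ^ b * d'" "\<not> p dvd d'"
    by (rule multiplicity_decompose'[of d p, folded assms(7)]) (rule that)
  \<comment> \<open>The prime-to-\<open>p\<close> part of \<open>(n - 1)^2 d\<close>; as
    \<open>p\<close> does not divide \<open>n\<close>, the exponent \<open>m\<close> is prime to
    \<open>p\<close> too.\<close>
  define c where "c = n'^2 * d'"
  define m where "m = n^5 * c"
  have "int n - 1 = int (n - 1)" using assms(1) by simp
  then have sq: "(int n - 1)^2 = int (p ^ (2 * a) * n'^2)"
    unfolding n'(1) by (simp add: power_mult_distrib power_mult[symmetric] mult.commute)
  have prime_to_p: "coprime x p" if "\<not> p dvd x" for x
    using prime_imp_coprime[OF assms(4) that] by (simp add: coprime_commute)
  have coprime: "coprime n p" "coprime m p"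
    using prime_to_p[OF assms(5)] prime_to_p[OF n'(2)] prime_to_p[OF d'(2)] by (simp_all add: m_def c_def)
  interpret A: comm_group A unfolding A_def by (rule comm_group_int_vectors)
  interpret L: group_hom A A "reduced_laplacian_map Y q"
    by unfold_locales (unfold A_def, rule reduced_laplacian_map_hom)
  have H: "subgroup H A" unfolding H_def by (rule L.img_is_subgroup)
  have J: "jacobian Y q = A Mod H" by (simp add: jacobian_def A_def H_def)
  interpret T: group T unfolding T_def by (rule group_cyclic_sum)
  have card_T: "card (carrier T) = p ^ (2 * a * (d - 2) + (2 * a + b))"
    unfolding T_def using p by (subst card_cyclic_sum) (simp_all add: power_mult power_add)
  have f_hom: "f \<in> hom A T" unfolding f_def A_def T_def using p by (intro coord_map_hom) auto
  interpret f: group_hom A T f using f_hom by unfold_locales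
  have f_onto: "f ` carrier A = carrier T"
    unfolding f_def A_def T_def using p coprime(1) assms(2,3)
    by (intro coord_map_onto) (auto simp: power_add)
  have f_H: "f x = \<one>\<^bsub>T\<^esub>" if "x \<in> H" for x
  proof -
    obtain z where "x = reduced_laplacian_map Y q z" using \<open>x \<in> H\<close> unfolding H_def by blast
    moreover have "int (p ^ (2 * a)) dvd (int n - 1)^2" unfolding sq by simp
    moreover have "int (p ^ (2 * a + b)) dvd (int n - 1)^2 * int d"
      unfolding sq d'(1) power_add of_nat_mult[symmetric] by (simp only: of_nat_dvd_iff) (intro mult_dvd_mono dvd_triv_left)
    ultimately show ?thesis
      unfolding f_def T_def using coord_map_reduced_laplacian[OF _ _ assms(3)] by blast
  qed
  have kernel: "x [^]\<^bsub>A\<^esub> m \<in> H" if "x \<in> carrier A" "f x = \<one>\<^bsub>T\<^esub>" for x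
    using that unfolding A_def H_def m_def f_def T_def
  proof (intro coord_map_kernel[OF assms(1-3)])
    show "(int n - 1)^2 dvd int c * int (p ^ (2 * a))" unfolding sq c_def by simp
    show "(int n - 1)^2 * int d dvd int c * int (p ^ (2 * a + b))"
      unfolding sq c_def by (subst d'(1)) (simp add: power_add mult_ac)
  qed auto
  have "finite (carrier (A Mod H))"
    unfolding A_def
  proof (rule finite_int_vectors_Mod)
    show "subgroup H (int_vectors (pverts Y - {q}))" using H by (simp add: A_def)
    have "m \<noteq> 0" using coprime(2) assms(4) not_prime_unit by (metis coprime_0_left_iff)
    then show "card (carrier T) * m > 0" using p card_T by simp
    fix X assume "X \<in> carrier (int_vectors (pverts Y - {q}))"
    then have X: "X \<in> carrier A" by (simp add: A_def)
    \<comment> \<open>The \<open>card (carrier T)\<close>-fold multiple of \<open>X\<close> lies in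
      the kernel of \<open>f\<close>, so a further factor \<open>m\<close> brings it into
      \<open>H\<close>.\<close>
    have "f (X [^]\<^bsub>A\<^esub> card (carrier T)) = f X [^]\<^bsub>T\<^esub> card (carrier T)" using X by (rule f.hom_nat_pow)
    also have "\<dots> = \<one>\<^bsub>T\<^esub>" using T.pow_order_eq_1[of "f X"] X by (simp add: order_def)
    finally have "(X [^]\<^bsub>A\<^esub> card (carrier T)) [^]\<^bsub>A\<^esub> m \<in> H" using X by (intro kernel A.nat_pow_closed)
    then show "X [^]\<^bsub>int_vectors (pverts Y - {q})\<^esub> (card (carrier T) * m) \<in> H"
      using A.nat_pow_pow[OF X] by (simp add: A_def)
  qed simp
  moreover from this have "sylow_group (A Mod H) p \<cong> T"
    using sylow_group_FactGroup_iso[OF A.comm_group_axioms H _ assms(4) coprime(2) T.is_group card_T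
        f_hom f_onto f_H kernel] by blast
  ultimately show ?thesis unfolding J by blast
qed

end

theorem theorem8:
  fixes G :: "('g, 'm) monoid_scheme" and \<tau> :: 'g and n d p a b :: nat and q :: "nat \<times> 'g"
  assumes "n \<ge> 3" and "d \<ge> 3"
    and "group G" and "\<tau> \<in> carrier G" and "generate G {\<tau>} = carrier G" and "order G = d"
    and "prime p" and "\<not> p dvd n"
    and "a = multiplicity p (n - 1)" and "b = multiplicity p d"
    and "q \<in> pverts (single_voltage_cover n G \<tau>)"
  defines "J \<equiv> jacobian (single_voltage_cover n G \<tau>) q"
  shows "finite (carrier J)
    \<and> sylow_group J p \<cong>
        product_group {..<d - 2} (\<lambda>_. integer_mod_group (p ^ (2 * a)))
          \<times>\<times> integer_mod_group (p ^ (2 * a + b))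
    \<and> order (sylow_group J p) = p ^ (2 * a * (d - 1) + b)
    \<and> (p dvd n - 1 \<longrightarrow> p_rank J p = d - 1)"
proof -
  let ?T = "cyclic_sum (d - 2) (p ^ (2 * a)) (p ^ (2 * a + b))"
  \<comment> \<open>An infinite carrier would have \<open>order\<close> 0, contrary to
    \<open>d\<close> being at least 3.\<close>
  have "finite (carrier G)"
    using assms(2,6) by (metis card.infinite not_numeral_le_zero order_def)
  then interpret cyclic_cover G \<tau> n d
    using assms(1-6) by (intro cyclic_cover.intro voltage_cover.intro voltage_cover_axioms.intro
        cyclic_cover_axioms.intro) auto
  have p: "p > 0" using assms(7) prime_gt_0_nat by blast
  have fin: "finite (carrier J)" and iso: "sylow_group J p \<cong> ?T"
    using jacobian_sylow[OF _ _ assms(11,7,8,9,10)] assms(1,2) unfolding J_def by simp_all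
  have comm: "comm_group J" unfolding J_def by (rule comm_group_jacobian)
  have "subgroup (carrier (sylow_group J p)) J"
    using is_sylow_subgroup_sylow_group[OF comm fin assms(7)] by (simp add: is_sylow_subgroup_def)
  then have "group (J\<lparr>carrier := carrier (sylow_group J p)\<rparr>)"
    using comm by (intro subgroup.subgroup_is_group) (auto simp: comm_group_def)
  then have group_sylow: "group (sylow_group J p)" by (simp add: sylow_group_def)
  have "2 * a * (d - 1) + b = 2 * a * (d - 2) + (2 * a + b)"
    using assms(2) by (simp add: algebra_simps flip: mult_Suc_right)
  then have "order (sylow_group J p) = p ^ (2 * a * (d - 1) + b)"
    using iso_same_card[OF iso] p unfolding order_def
    by (subst (asm) card_cyclic_sum) (simp_all add: power_mult power_add)
  moreover have "p_rank J p = d - 1" if "p dvd n - 1"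
  proof -
    \<comment> \<open>This makes \<open>p\<close> divide the order of each of the
      \<open>d - 1\<close> cyclic factors. For \<open>a = 0\<close> the decomposition would leave at
      most one nontrivial factor, of order \<open>p ^ b\<close>, so the rank would be at most 1,
      less than \<open>d - 1\<close>.\<close>
    have "a > 0" using that assms(1,7,9) by (simp add: prime_multiplicity_gt_zero_iff)
    then have "p dvd p ^ (2 * a)" "p dvd p ^ (2 * a + b)" by (simp_all add: dvd_power)
    then have "min_generators ?T = Suc (d - 2)"
      using p assms(7) by (intro min_generators_cyclic_sum) auto
    then show ?thesis
      using min_generators_iso[OF group_sylow group_cyclic_sum iso] assms(2) by (simp add: p_rank_def)
  qed
  ultimately show ?thesis using fin iso by blast
qed

end
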